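(* Let $m\ge 3$ be odd, $q=2^m$, $N=2q=2^{m+1}$. Let $K\subseteq \mathbb{Z}_4^q$ be a $\mathbb{Z}_4$-linear Kerdock code and $P=K^{\perp}$ the corresponding $\mathbb{Z}_4$-linear Preparata code (see context). Fix a coordinate position $i$. Let $K_{\rm short}\subseteq \mathbb{Z}_4^{q-1}$ be the code obtained from $K$ by shortening at $i$, let $C=P_{\rm punct}\subseteq \mathbb{Z}_4^{q-1}$ be the code obtained from $P$ by puncturing at $i$, and let $A=\mathbb{Z}_4^{q-1}$ (so $K_{\rm short}^{\perp}=C$ and $|K_{\rm short}|=|A/C|=4^m$). (i) Define relations on $K_{\rm short}$ by: $(x,y)\in R_0$ if $x-y$ has Lee weight $0$; $(x,y)\in R_1$ if $x-y$ has Lee weight $2^m+2^{(m-1)/2}$; $(x,y)\in R_2$ if $x-y$ has Lee weight $2^m-2^{(m-1)/2}$; $(x,y)\in R_3$ if $x-y$ has Lee weight $2^m$. Then $(K_{\rm short},\{R_0,R_1,R_2,R_3\})$ is a three-class (abelian) association scheme with first and second eigenmatrices $$P=\begin{pmatrix} 1 & \frac{(N-2\sqrt{N})(N-2)}{8} & \frac{(N+2\sqrt{N})(N-2)}{8} & \frac{N}{2}-1 \\ 1 & -\frac{\sqrt{N}(N-4)}{8} & \frac{\sqrt{N}(N-4)}{8} & -1 \\ 1 & \frac{\sqrt{N}}{2} & -\frac{\sqrt{N}}{2} & -1 \\ 1 & -\frac{N-2\sqrt{N}}{4} & -\frac{N+2\sqrt{N}}{4} & \frac{N}{2}-1 \end{pmatrix},\qquad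 Q=\begin{pmatrix} 1 & N-2 & \frac{(N-2)(N-4)}{4} & \frac{N}{2}-1 \\ 1 & -\sqrt{N}-2 & \sqrt{N}+2 & -1 \\ 1 & \sqrt{N}-2 & -\sqrt{N}+2 & -1 \\ 1 & -2 & -\frac{N}{2}+2 & \frac{N}{2}-1 \end{pmatrix}.$$ (ii) Let $e_j$ denote the $j$-th standard unit vector of $A$. Define relations on the set $A/C$ of cosets by: $(x,y)\in R'_0$ if $x-y= C$; $(x,y)\in R'_1$ if $x-y=\pm e_j+C$ for some $j$; $(x,y)\in R'_2$ if $x-y=e_j-e_k+C$ for some $j\neq k$; $(x,y)\in R'_3$ if $x-y=2e_j+C$ for some $j$. Then $(A/C,\{R'_0,\dots,R'_3\})$ is a three-class association scheme which is the dual of the scheme in (i) (with respect to the nondegenerate pairing $K_{\rm short}\times A/C\to\mathbb{Z}_4$, $(x,y+C)\mapsto x\cdot y$, identifying $A/C$ with the character group of $K_{\rm short}$), and its first and second eigenmatrices are $P'=Q$ and $Q'=P$.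
   Context: $\mathbb{Z}_4$-valued quadratic forms: let $V=\mathbb{F}_2^m$; for a binary symmetric $m\times m$ matrix $R$ (entries identified with $0,1\in\mathbb{Z}_4$) define $T_R:V\to\mathbb{Z}_4$ by $T_R(v)=\sum_i R_{ii}\hat v_i^2+2\sum_{i<j}R_{ij}\hat v_i\hat v_j$, where $\hat v\in\mathbb{Z}_4^m$ reduces to $v$ mod 2. A $\mathbb{Z}_4$-Kerdock code of length $q=2^m$ (coordinates indexed by $V$) is a code $\{(T_R(v)+2\hat s\cdot\hat v+\varepsilon)_{v\in V}: R\in S,\ s\in V,\ \varepsilon\in\mathbb{Z}_4\}$, where $S$ is a set of $2^m$ binary symmetric $m\times m$ matrices whose pairwise differences are nonsingular; it is called $\mathbb{Z}_4$-linear if it is an additive subgroup of $\mathbb{Z}_4^q$ (e.g. the Hammons–Kumar–Calderbank–Sloane–Solé quaternary Kerdock code built from the Galois ring $GR(4,m)$). The Preparata code is $P=K^\perp$ with respect to the standard dot product over $\mathbb{Z}_4$. Lee weight on $\mathbb{Z}_4$: $wt(0)=0$, $wt(\pm1)=1$, $wt(2)=2$, extended additively to vectors. Puncturing at $i$ deletes coordinate $i$ from all codewords; shortening at $i$ takes the codewords with $0$ at $i$ and deletes that coordinate. Eigenmatrix conventions: for a scheme with adjacency matrices $A_j$ and primitive idempotents $E_i$, $A_j=\sum_i P_{ij}E_i$ and $E_j=\frac{1}{|X|}\sum_i Q_{ij}A_i$. *)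

theory Defs
  imports
    "HOL-Library.Z2"
    "HOL-Library.Numeral_Type"
    "HOL-Analysis.Cartesian_Space"
    "HOL-Algebra.Product_Groups"
begin

section \<open>Words and codes over $Z_4$\<close>

text \<open>
  The ring $Z_4$ is the numeral type \<^typ>\<open>4\<close>, the field $F_2$ is \<^typ>\<open>bit\<close>.  A word with
  coordinate set \<open>I\<close> is an extensional function on \<open>I\<close>, so that deleting a coordinate is
  \<^const>\<open>restrict\<close>.
\<close>

definition Z4 :: "4 monoid"
  where "Z4 = \<lparr>carrier = UNIV, monoid.mult = (+), one = 0\<rparr>"

definition word_group :: "'v set \<Rightarrow> ('v \<Rightarrow> 4) monoid"
  where "word_group I = product_group I (\<lambda>_. Z4)"

definition dot_product :: "'v set \<Rightarrow> ('v \<Rightarrow> 4) \<Rightarrow> ('v \<Rightarrow> 4) \<Rightarrow> 4"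
  where "dot_product I x y = (\<Sum>j\<in>I. x j * y j)"

definition lee_weight1 :: "4 \<Rightarrow> nat"
  where "lee_weight1 a = (if a = 0 then 0 else if a = 2 then 2 else 1)"

definition lee_weight :: "'v set \<Rightarrow> ('v \<Rightarrow> 4) \<Rightarrow> nat"
  where "lee_weight I x = (\<Sum>j\<in>I. lee_weight1 (x j))"

definition unit_word :: "'v set \<Rightarrow> 'v \<Rightarrow> 'v \<Rightarrow> 4"
  where "unit_word I j = (\<lambda>k\<in>I. if k = j then 1 else 0)"

definition dual_code :: "'v set \<Rightarrow> ('v \<Rightarrow> 4) set \<Rightarrow> ('v \<Rightarrow> 4) set"
  where "dual_code I K = {y \<in> carrier (word_group I). \<forall>x\<in>K. dot_product I x y = 0}"

definition puncture :: "'v set \<Rightarrow> 'v \<Rightarrow> ('v \<Rightarrow> 4) set \<Rightarrow> ('v \<Rightarrow> 4) set"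
  where "puncture I i K = (\<lambda>x. restrict x (I - {i})) ` K"

definition shorten :: "'v set \<Rightarrow> 'v \<Rightarrow> ('v \<Rightarrow> 4) set \<Rightarrow> ('v \<Rightarrow> 4) set"
  where "shorten I i K = (\<lambda>x. restrict x (I - {i})) ` {x \<in> K. x i = 0}"


section \<open>Kerdock codes\<close>

type_synonym 'm bvec = "(bit, 'm) vec"

text \<open>
  The forms below do not depend on the chosen lift of a vector from $F_2$ to $Z_4$; the lift with
  entries 0, 1 is used.
\<close>

definition lift4 :: "bit \<Rightarrow> 4"
  where "lift4 b = (if b = 0 then 0 else 1)"

definition quad_form ::
    "bit^'m::{finite,linorder}^'m::{finite,linorder} \<Rightarrow> 'm bvec \<Rightarrow> 4"
  where "quad_form R v =
    (\<Sum>i\<in>UNIV. lift4 (R $ i $ i) * (lift4 (v $ i))\<^sup>2) +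
    2 * (\<Sum>i\<in>UNIV. \<Sum>j | i < j. lift4 (R $ i $ j) * lift4 (v $ i) * lift4 (v $ j))"

definition kerdock_set :: "(bit^'m^'m) set \<Rightarrow> bool"
  where "kerdock_set S \<longleftrightarrow>
    card S = 2 ^ CARD('m) \<and>
    (\<forall>R\<in>S. Finite_Cartesian_Product.transpose R = R) \<and>
    (\<forall>R\<in>S. \<forall>R'\<in>S. R \<noteq> R' \<longrightarrow> invertible (R - R'))"

definition kerdock_words ::
    "(bit^'m::{finite,linorder}^'m::{finite,linorder}) set \<Rightarrow> ('m bvec \<Rightarrow> 4) set"
  where "kerdock_words S =
    {(\<lambda>v. quad_form R v + 2 * (\<Sum>i\<in>UNIV. lift4 (s $ i) * lift4 (v $ i)) + \<epsilon>) | R s \<epsilon>. R \<in> S}"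

definition kerdock_code :: "('m::{finite,linorder} bvec \<Rightarrow> 4) set \<Rightarrow> bool"
  where "kerdock_code K \<longleftrightarrow> (\<exists>S. kerdock_set S \<and> K = kerdock_words S)"


section \<open>Association schemes\<close>

definition association_scheme :: "'a set \<Rightarrow> nat \<Rightarrow> (nat \<Rightarrow> ('a \<times> 'a) set) \<Rightarrow> bool"
  where "association_scheme X d R \<longleftrightarrow>
    finite X \<and> X \<noteq> {} \<and>
    R 0 = Id_on X \<and>
    (\<Union>i\<le>d. R i) = X \<times> X \<and>
    (\<forall>i\<le>d. R i \<noteq> {}) \<and>
    (\<forall>i\<le>d. \<forall>j\<le>d. i \<noteq> j \<longrightarrow> R i \<inter> R j = {}) \<and>
    (\<forall>i\<le>d. sym (R i)) \<and>
    (\<forall>i\<le>d. \<forall>j\<le>d. \<forall>k\<le>d. \<exists>p. \<forall>(x, y)\<in>R k. card {z \<in> X. (x, z) \<in> R i \<and> (z, y) \<in> R j} = p)"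

definition abelian_scheme ::
    "('a, 'b) monoid_scheme \<Rightarrow> nat \<Rightarrow> (nat \<Rightarrow> ('a \<times> 'a) set) \<Rightarrow> bool"
  where "abelian_scheme G d R \<longleftrightarrow>
    comm_group G \<and> association_scheme (carrier G) d R \<and>
    (\<forall>i\<le>d. \<forall>(x, y)\<in>R i. \<forall>z\<in>carrier G. (x \<otimes>\<^bsub>G\<^esub> z, y \<otimes>\<^bsub>G\<^esub> z) \<in> R i)"

definition diff_rel :: "('a, 'b) monoid_scheme \<Rightarrow> 'a set \<Rightarrow> ('a \<times> 'a) set"
  where "diff_rel G D =
    {(x, y). x \<in> carrier G \<and> y \<in> carrier G \<and> x \<otimes>\<^bsub>G\<^esub> inv\<^bsub>G\<^esub> y \<in> D}"

text \<open>
  Matrices indexed by \<open>X\<close> are functions of two arguments that vanish outside \<open>X \<times> X\<close>.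
\<close>

type_synonym 'a cmatrix = "'a \<Rightarrow> 'a \<Rightarrow> complex"

definition adjacency :: "('a \<times> 'a) set \<Rightarrow> 'a cmatrix"
  where "adjacency r = (\<lambda>x y. of_bool ((x, y) \<in> r))"

definition cmat_mult :: "'a set \<Rightarrow> 'a cmatrix \<Rightarrow> 'a cmatrix \<Rightarrow> 'a cmatrix"
  where "cmat_mult X M M' = (\<lambda>x y. \<Sum>z\<in>X. M x z * M' z y)"

definition bose_mesner :: "nat \<Rightarrow> (nat \<Rightarrow> ('a \<times> 'a) set) \<Rightarrow> 'a cmatrix set"
  where "bose_mesner d R = {(\<lambda>x y. \<Sum>i\<le>d. c i * adjacency (R i) x y) | c. True}"

definition primitive_idempotent ::
    "'a set \<Rightarrow> nat \<Rightarrow> (nat \<Rightarrow> ('a \<times> 'a) set) \<Rightarrow> 'a cmatrix \<Rightarrow> bool"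
  where "primitive_idempotent X d R e \<longleftrightarrow>
    e \<in> bose_mesner d R \<and> e \<noteq> (\<lambda>x y. 0) \<and> cmat_mult X e e = e \<and>
    (\<forall>f\<in>bose_mesner d R. cmat_mult X f f = f \<and> cmat_mult X e f = f \<longrightarrow> f = (\<lambda>x y. 0) \<or> f = e)"

definition idempotent_ordering ::
    "'a set \<Rightarrow> nat \<Rightarrow> (nat \<Rightarrow> ('a \<times> 'a) set) \<Rightarrow> (nat \<Rightarrow> 'a cmatrix) \<Rightarrow> bool"
  where "idempotent_ordering X d R E \<longleftrightarrow>
    bij_betw E {..d} {e. primitive_idempotent X d R e} \<and>
    E 0 = (\<lambda>x y. of_bool (x \<in> X \<and> y \<in> X) / of_nat (card X))"

definition first_eigenmatrix ::
    "nat \<Rightarrow> (nat \<Rightarrow> ('a \<times> 'a) set) \<Rightarrow> (nat \<Rightarrow> 'a cmatrix) \<Rightarrow> (nat \<Rightarrow> nat \<Rightarrow> real) \<Rightarrow> bool"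
  where "first_eigenmatrix d R E P \<longleftrightarrow>
    (\<forall>j\<le>d. adjacency (R j) = (\<lambda>x y. \<Sum>i\<le>d. of_real (P i j) * E i x y))"

definition second_eigenmatrix ::
    "'a set \<Rightarrow> nat \<Rightarrow> (nat \<Rightarrow> ('a \<times> 'a) set) \<Rightarrow> (nat \<Rightarrow> 'a cmatrix) \<Rightarrow> (nat \<Rightarrow> nat \<Rightarrow> real) \<Rightarrow> bool"
  where "second_eigenmatrix X d R E Q \<longleftrightarrow>
    (\<forall>j\<le>d. E j =
      (\<lambda>x y. 1 / of_nat (card X) * (\<Sum>i\<le>d. of_real (Q i j) * adjacency (R i) x y)))"


section \<open>Characters and dual schemes\<close>

definition character_group :: "('a, 'b) monoid_scheme \<Rightarrow> ('a \<Rightarrow> complex) monoid"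
  where "character_group G =
    \<lparr>carrier = {\<phi> \<in> extensional (carrier G). \<phi> \<one>\<^bsub>G\<^esub> = 1 \<and>
        (\<forall>x\<in>carrier G. \<forall>y\<in>carrier G. \<phi> (x \<otimes>\<^bsub>G\<^esub> y) = \<phi> x * \<phi> y)},
     monoid.mult = (\<lambda>\<phi> \<psi>. \<lambda>x\<in>carrier G. \<phi> x * \<psi> x),
     one = (\<lambda>x\<in>carrier G. 1)\<rparr>"

text \<open>
  Each character is a common eigenvector of the adjacency matrices of an abelian scheme, hence lies
  in the column space of exactly one primitive idempotent.  The \<open>j\<close>-th class of the dual scheme joins two characters whose
  quotient lies in the column space of \<open>E j\<close>.
\<close>

definition dual_relation ::
    "('a, 'b) monoid_scheme \<Rightarrow> (nat \<Rightarrow> 'a cmatrix) \<Rightarrow> nat \<Rightarrow> (('a \<Rightarrow> complex) \<times> ('a \<Rightarrow> complex)) set"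
  where "dual_relation G E j = diff_rel (character_group G)
    {\<phi> \<in> carrier (character_group G).
       \<forall>x\<in>carrier G. (\<Sum>z\<in>carrier G. E j x z * \<phi> z) = \<phi> x}"

definition nondegenerate_pairing ::
    "('a, 'c) monoid_scheme \<Rightarrow> ('b, 'd) monoid_scheme \<Rightarrow> ('a \<Rightarrow> 'b \<Rightarrow> 4) \<Rightarrow> bool"
  where "nondegenerate_pairing G H \<beta> \<longleftrightarrow>
    (\<forall>x\<in>carrier G. \<beta> x \<in> hom H Z4) \<and>
    (\<forall>y\<in>carrier H. (\<lambda>x. \<beta> x y) \<in> hom G Z4) \<and>
    (\<forall>x\<in>carrier G. (\<forall>y\<in>carrier H. \<beta> x y = 0) \<longrightarrow> x = \<one>\<^bsub>G\<^esub>) \<and>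
    (\<forall>y\<in>carrier H. (\<forall>x\<in>carrier G. \<beta> x y = 0) \<longrightarrow> y = \<one>\<^bsub>H\<^esub>)"

text \<open>The embedding $a \mapsto i^a$ of $Z_4$ into the multiplicative group of complex numbers.\<close>

definition i_power :: "4 \<Rightarrow> complex"
  where "i_power a = (if a = 0 then 1 else if a = 1 then \<i> else if a = 2 then -1 else -\<i>)"

definition pairing_character ::
    "('a, 'b) monoid_scheme \<Rightarrow> ('a \<Rightarrow> 'h \<Rightarrow> 4) \<Rightarrow> 'h \<Rightarrow> 'a \<Rightarrow> complex"
  where "pairing_character G \<beta> y = (\<lambda>x\<in>carrier G. i_power (\<beta> x y))"

definition dual_scheme_via ::
    "('a, 'c) monoid_scheme \<Rightarrow> (nat \<Rightarrow> 'a cmatrix) \<Rightarrow> ('b, 'd) monoid_scheme \<Rightarrow>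
     nat \<Rightarrow> (nat \<Rightarrow> ('b \<times> 'b) set) \<Rightarrow> ('a \<Rightarrow> 'b \<Rightarrow> 4) \<Rightarrow> bool"
  where "dual_scheme_via G E H d R' \<beta> \<longleftrightarrow>
    nondegenerate_pairing G H \<beta> \<and>
    pairing_character G \<beta> \<in> iso H (character_group G) \<and>
    (\<forall>j\<le>d. \<forall>y\<in>carrier H. \<forall>y'\<in>carrier H.
       (y, y') \<in> R' j \<longleftrightarrow>
       (pairing_character G \<beta> y, pairing_character G \<beta> y') \<in> dual_relation G E j)"

text \<open>
  The value $x \cdot y$ for any \<open>y\<close> in the coset \<open>Y\<close>; meaningful if it does not depend on \<open>y\<close>.
\<close>

definition coset_pairing :: "'v set \<Rightarrow> ('v \<Rightarrow> 4) \<Rightarrow> ('v \<Rightarrow> 4) set \<Rightarrow> 4"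
  where "coset_pairing I x Y = the_elem (dot_product I x ` Y)"


section \<open>The eigenmatrices\<close>

definition P_matrix :: "real \<Rightarrow> nat \<Rightarrow> nat \<Rightarrow> real"
  where "P_matrix N i j =
    [[1, (N - 2 * sqrt N) * (N - 2) / 8, (N + 2 * sqrt N) * (N - 2) / 8, N / 2 - 1],
     [1, - (sqrt N * (N - 4) / 8),       sqrt N * (N - 4) / 8,           -1],
     [1, sqrt N / 2,                     - (sqrt N / 2),                 -1],
     [1, - ((N - 2 * sqrt N) / 4),       - ((N + 2 * sqrt N) / 4),       N / 2 - 1]] ! i ! j"

definition Q_matrix :: "real \<Rightarrow> nat \<Rightarrow> nat \<Rightarrow> real"
  where "Q_matrix N i j =
    [[1, N - 2,        (N - 2) * (N - 4) / 4, N / 2 - 1],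
     [1, - sqrt N - 2, sqrt N + 2,            -1],
     [1, sqrt N - 2,   - sqrt N + 2,          -1],
     [1, -2,           - (N / 2) + 2,         N / 2 - 1]] ! i ! j"

end

theory Submission
  imports Defs
begin

text \<open>
  For a nondegenerate pairing of finite abelian groups \<open>G\<close>, \<open>H\<close> with values in $Z_4$ and partitions
  of \<open>G\<close> and \<open>H\<close> whose classes have character sums that are constant on the classes of the other
  partition, the class sums of characters give the primitive idempotents, and the two tables of
  character sums are the eigenmatrices of a pair of dual schemes.

  Here \<open>G\<close> is the shortened Kerdock code and \<open>H = A/C\<close>.  With the convention \<open>e i = 0\<close>, the cosets
  of \<open>e j - e k\<close> for \<open>j \<noteq> k\<close> and of \<open>2 e j\<close> are indexed by pairs of coordinates.  They are distinct because
  a Kerdock set maps bijectively onto $V$ under both \<open>R \<mapsto> R w\<close> (\<open>w \<noteq> 0\<close>) and \<open>R \<mapsto> diag R\<close>, the latter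
  since \<open>m\<close> is odd; by counting, they are all cosets.  The character sums over the classes of \<open>A/C\<close> at a
  codeword \<open>x\<close> depend only on $W = \sum_v i^{x_v}$ and $\sum_v (-1)^{x_v}$, and \<open>q - Re W\<close> is
  the Lee weight of \<open>x\<close>.  If \<open>x\<close> comes from a nonsingular form then $W$ is a Gaussian integer of norm
  $2^m$ with \<open>m\<close> odd, so its real part is one of $\pm 2^{(m-1)/2}$.
\<close>

section \<open>The pairing of two finite abelian groups\<close>

text \<open>The convention \<open>e i = 0\<close> works because a linear Kerdock code contains the
  constant words: subtracting the constant \<open>x i\<close> turns any word of \<open>K\<close>
  into one vanishing at \<open>i\<close>, so a statement about all shortened words can be tested on
  all of \<open>K\<close>. Of the q^2 pairs of positions, the q diagonal ones would all give the
  zero coset as differences; they are used for the doubles instead. This leaves exactly q^2 = 4^m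
  candidates, the same number as the bound |S| |V| on the shortened code, so injectivity on pairs
  also delivers both cardinalities.

  Only the sums over coset classes are computed directly. The opposite sums, and with them the
  number of words of each weight, follow from the matrix identity QP = 4^m I, so no weight
  distribution has to be found. The condition m >= 3 keeps the first rows of both matrices free of
  zeros, hence all classes nonempty: for m = 1 one has N = 4, and the factors N - 4 and N - 2 sqrt N
  vanish.\<close>

lemma exhaust_Z4:
  fixes a :: 4
  obtains "a = 0" | "a = 1" | "a = 2" | "a = 3"
  using exhaust_4[of a] by auto

lemma i_power_simps [simp]:
  "i_power 0 = 1" "i_power 1 = \<i>" "i_power 2 = -1" "i_power 3 = -\<i>"
  by (simp_all add: i_power_def)

lemma i_power_add: "i_power (a + b) = i_power a * i_power b"
  by (cases a rule: exhaust_Z4; cases b rule: exhaust_Z4; simp add: i_power_def)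

lemma i_power_nonzero [simp]: "i_power a \<noteq> 0"
  by (simp add: i_power_def)

lemma i_power_eq_1_iff: "i_power a = 1 \<longleftrightarrow> a = 0"
  by (cases a rule: exhaust_Z4) (auto simp: complex_eq_iff)

lemma i_power_uminus: "i_power (- a) = cnj (i_power a)"
proof -
  have "i_power (- a) * i_power a = 1" by (simp flip: i_power_add)
  moreover have "cnj (i_power a) * i_power a = 1"
    by (cases a rule: exhaust_Z4) simp_all
  ultimately show ?thesis by (metis i_power_nonzero mult_right_cancel)
qed

lemma i_power_diff: "i_power (a - b) = i_power a * cnj (i_power b)"
  using i_power_add[of a "- b"] by (simp add: i_power_uminus)

lemma comm_group_Z4: "comm_group Z4"
proof (rule comm_groupI)
  show "\<exists>y\<in>carrier Z4. y \<otimes>\<^bsub>Z4\<^esub> x = \<one>\<^bsub>Z4\<^esub>" for x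
    by (intro bexI[of _ "- x"]) (simp_all add: Z4_def)
qed (simp_all add: Z4_def add.assoc add.commute)

text \<open>Translation by \<open>a\<close> permutes the group and multiplies the sum by
  \<open>f a\<close>. Only multiplicativity of \<open>f\<close> is required, so the lemma also
  applies to a quotient of two characters.\<close>

lemma (in group) sum_character_eq_0:
  fixes f :: "'a \<Rightarrow> complex"
  assumes mult: "\<And>x y. x \<in> carrier G \<Longrightarrow> y \<in> carrier G \<Longrightarrow> f (x \<otimes> y) = f x * f y"
    and a: "a \<in> carrier G" "f a \<noteq> 1"
  shows "(\<Sum>x\<in>carrier G. f x) = 0"
proof -
  have "(\<Sum>x\<in>carrier G. f x) = (\<Sum>x\<in>carrier G. f (a \<otimes> x))"
  proof (rule sum.reindex_bij_witness[where j = "\<lambda>x. inv a \<otimes> x" and i = "\<lambda>x. a \<otimes> x"])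
    show "a \<otimes> (inv a \<otimes> x) = x" "inv a \<otimes> (a \<otimes> x) = x" if "x \<in> carrier G" for x
      using that a(1) by (simp_all flip: m_assoc)
    then show "f (a \<otimes> (inv a \<otimes> x)) = f x" if "x \<in> carrier G" for x
      using that by simp
  qed (use a in auto)
  also have "\<dots> = f a * (\<Sum>x\<in>carrier G. f x)"
    using a(1) by (simp add: mult sum_distrib_left)
  finally show ?thesis using a(2) by simp
qed

locale z4_pairing = G: comm_group G + H: comm_group H
  for G :: "('a, 'c) monoid_scheme" and H :: "('b, 'd) monoid_scheme" +
  fixes \<beta> :: "'a \<Rightarrow> 'b \<Rightarrow> 4"
  assumes finite_G: "finite (carrier G)" and finite_H: "finite (carrier H)"
    and nondegenerate: "nondegenerate_pairing G H \<beta>"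
begin

definition chi :: "'a \<Rightarrow> 'b \<Rightarrow> complex"
  where "chi x y = i_power (\<beta> x y)"

lemma chi_nonzero [simp]: "chi x y \<noteq> 0"
  by (simp add: chi_def)

lemma chi_mult_left:
  assumes "x \<in> carrier G" "x' \<in> carrier G" "y \<in> carrier H"
  shows "chi (x \<otimes>\<^bsub>G\<^esub> x') y = chi x y * chi x' y"
proof -
  have "(\<lambda>x. \<beta> x y) \<in> hom G Z4"
    using nondegenerate assms by (auto simp: nondegenerate_pairing_def)
  with assms have "\<beta> (x \<otimes>\<^bsub>G\<^esub> x') y = \<beta> x y + \<beta> x' y"
    by (simp add: hom_def Z4_def)
  then show ?thesis by (simp add: chi_def i_power_add)
qed

lemma chi_mult_right:
  assumes "x \<in> carrier G" "y \<in> carrier H" "y' \<in> carrier H"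
  shows "chi x (y \<otimes>\<^bsub>H\<^esub> y') = chi x y * chi x y'"
proof -
  have "\<beta> x \<in> hom H Z4"
    using nondegenerate assms by (auto simp: nondegenerate_pairing_def)
  with assms have "\<beta> x (y \<otimes>\<^bsub>H\<^esub> y') = \<beta> x y + \<beta> x y'"
    by (simp add: hom_def Z4_def)
  then show ?thesis by (simp add: chi_def i_power_add)
qed

lemma chi_one_left [simp]: "y \<in> carrier H \<Longrightarrow> chi \<one>\<^bsub>G\<^esub> y = 1"
  using chi_mult_left[of "\<one>\<^bsub>G\<^esub>" "\<one>\<^bsub>G\<^esub>" y] by simp

lemma chi_one_right [simp]: "x \<in> carrier G \<Longrightarrow> chi x \<one>\<^bsub>H\<^esub> = 1"
  using chi_mult_right[of x "\<one>\<^bsub>H\<^esub>" "\<one>\<^bsub>H\<^esub>"] by simp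

lemma chi_inv_left: "x \<in> carrier G \<Longrightarrow> y \<in> carrier H \<Longrightarrow> chi (inv\<^bsub>G\<^esub> x) y = inverse (chi x y)"
  using chi_mult_left[of x "inv\<^bsub>G\<^esub> x" y] by (simp add: field_simps)

lemma chi_inv_right: "x \<in> carrier G \<Longrightarrow> y \<in> carrier H \<Longrightarrow> chi x (inv\<^bsub>H\<^esub> y) = inverse (chi x y)"
  using chi_mult_right[of x y "inv\<^bsub>H\<^esub> y"] by (simp add: field_simps)

lemma z4_pairing_flip: "z4_pairing H G (\<lambda>y x. \<beta> x y)"
  by unfold_locales
    (use finite_G finite_H nondegenerate in \<open>auto simp: nondegenerate_pairing_def\<close>)

lemma chi_flip: "z4_pairing.chi (\<lambda>y x. \<beta> x y) = (\<lambda>y x. chi x y)"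
  by (simp add: fun_eq_iff chi_def z4_pairing.chi_def[OF z4_pairing_flip])

lemma sum_chi_right:
  assumes x: "x \<in> carrier G"
  shows "(\<Sum>y\<in>carrier H. chi x y) = of_nat (card (carrier H)) * of_bool (x = \<one>\<^bsub>G\<^esub>)"
proof (cases "x = \<one>\<^bsub>G\<^esub>")
  case False
  with x nondegenerate obtain y where y: "y \<in> carrier H" "\<beta> x y \<noteq> 0"
    unfolding nondegenerate_pairing_def by blast
  then have "chi x y \<noteq> 1" by (simp add: chi_def i_power_eq_1_iff)
  with x y have "(\<Sum>y\<in>carrier H. chi x y) = 0"
    by (intro H.sum_character_eq_0[of _ y]) (auto simp: chi_mult_right)
  with False show ?thesis by simp
qed simp

lemma sum_chi_right2:
  assumes "x \<in> carrier G" "z \<in> carrier G"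
  shows "(\<Sum>y\<in>carrier H. chi x y * inverse (chi z y)) =
    of_nat (card (carrier H)) * of_bool (x = z)"
proof -
  have "(\<Sum>y\<in>carrier H. chi x y * inverse (chi z y)) = (\<Sum>y\<in>carrier H. chi (x \<otimes>\<^bsub>G\<^esub> inv\<^bsub>G\<^esub> z) y)"
    using assms by (intro sum.cong) (auto simp: chi_mult_left chi_inv_left)
  also have "\<dots> = of_nat (card (carrier H)) * of_bool (x = z)"
    using assms by (subst sum_chi_right) (auto simp: G.inv_solve_right')
  finally show ?thesis .
qed

end

text \<open>The axioms are symmetric in the two groups, so the locale contains itself with
  \<open>G\<close> and \<open>H\<close> exchanged. The rewrite keeps the single symbol
  \<open>chi\<close> with its arguments in fixed order; \<open>flip\<close> facts are then the
  column versions of the row facts.\<close>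

sublocale z4_pairing \<subseteq> flip: z4_pairing H G "\<lambda>y x. \<beta> x y"
  rewrites "flip.chi = (\<lambda>y x. chi x y)"
  by (rule z4_pairing_flip) (rule chi_flip)

context z4_pairing
begin

text \<open>The sum of the whole character table, taken by rows, is |H|, because only the row of the
  identity contributes; taken by columns it is |G|.\<close>

lemma card_eq: "card (carrier G) = card (carrier H)"
proof -
  have "(\<Sum>x\<in>carrier G. \<Sum>y\<in>carrier H. chi x y) = of_nat (card (carrier H))"
    using finite_G by (simp add: sum_chi_right of_bool_def if_distrib sum.delta cong: if_cong)
  moreover have "(\<Sum>y\<in>carrier H. \<Sum>x\<in>carrier G. chi x y) = of_nat (card (carrier G))"
    using finite_H by (simp add: flip.sum_chi_right of_bool_def if_distrib sum.delta cong: if_cong)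
  ultimately have "(of_nat (card (carrier G)) :: complex) = of_nat (card (carrier H))"
    using sum.swap[of chi "carrier H" "carrier G"] by simp
  then show ?thesis by (rule of_nat_eq_iff[THEN iffD1])
qed

lemma card_pos: "card (carrier G) > 0" "card (carrier H) > 0"
  using finite_G finite_H by (auto simp: card_gt_0_iff)

lemma pairing_character_eq: "x \<in> carrier G \<Longrightarrow> pairing_character G \<beta> y x = chi x y"
  by (simp add: pairing_character_def chi_def)

lemma pairing_character_closed:
  "y \<in> carrier H \<Longrightarrow> pairing_character G \<beta> y \<in> carrier (character_group G)"
  by (auto simp: character_group_def pairing_character_def chi_mult_left simp flip: chi_def)

lemma chi_separates:
  assumes "y \<in> carrier H" "y' \<in> carrier H" "\<And>x. x \<in> carrier G \<Longrightarrow> chi x y = chi x y'"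
  shows "y = y'"
proof -
  have "(\<Sum>x\<in>carrier G. chi x y * inverse (chi x y')) = of_nat (card (carrier G))"
    using assms by simp
  with flip.sum_chi_right2[of y y'] assms card_pos show ?thesis
    by (simp split: if_splits)
qed

text \<open>Completeness by Fourier inversion: a character different from every
  \<open>chi _ y\<close> is orthogonal to all of them, but adding up its Fourier coefficients over
  \<open>H\<close> recovers |H| times its value 1 at the identity.\<close>

lemma character_is_chi:
  assumes \<phi>: "\<phi> \<in> carrier (character_group G)"
  obtains y where "y \<in> carrier H" "\<And>x. x \<in> carrier G \<Longrightarrow> \<phi> x = chi x y"
proof (rule ccontr)
  assume "\<not> thesis"
  with that have no: "\<exists>x\<in>carrier G. \<phi> x \<noteq> chi x y" if "y \<in> carrier H" for y
    using \<open>y \<in> carrier H\<close> by blast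
  have mult: "\<phi> (x \<otimes>\<^bsub>G\<^esub> y) = \<phi> x * \<phi> y" if "x \<in> carrier G" "y \<in> carrier G" for x y
    using \<phi> that by (simp add: character_group_def)
  have zero: "(\<Sum>x\<in>carrier G. \<phi> x * inverse (chi x y)) = 0" if y: "y \<in> carrier H" for y
  proof -
    obtain x where "x \<in> carrier G" "\<phi> x \<noteq> chi x y" using no y by blast
    then show ?thesis using y
      by (intro G.sum_character_eq_0[of _ x]) (auto simp: mult chi_mult_left field_simps)
  qed
  have "0 = (\<Sum>y\<in>carrier H. (\<Sum>x\<in>carrier G. \<phi> x * inverse (chi x y)))"
    by (simp add: zero)
  also have "\<dots> = (\<Sum>x\<in>carrier G. \<phi> x * (\<Sum>y\<in>carrier H. chi \<one>\<^bsub>G\<^esub> y * inverse (chi x y)))"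
    by (subst sum.swap) (simp add: sum_distrib_left)
  also have "\<dots> = (\<Sum>x\<in>carrier G. if x = \<one>\<^bsub>G\<^esub> then \<phi> x * of_nat (card (carrier H)) else 0)"
    by (intro sum.cong refl) (use sum_chi_right2[of "\<one>\<^bsub>G\<^esub>"] in auto)
  also have "\<dots> = \<phi> \<one>\<^bsub>G\<^esub> * of_nat (card (carrier H))"
    using finite_G by simp
  finally show False
    using \<phi> card_pos by (simp add: character_group_def)
qed

lemma pairing_character_iso: "pairing_character G \<beta> \<in> iso H (character_group G)"
proof (rule isoI)
  show "pairing_character G \<beta> \<in> hom H (character_group G)"
  proof (rule homI)
    show "pairing_character G \<beta> y \<in> carrier (character_group G)" if "y \<in> carrier H" for y
      using that by (rule pairing_character_closed)
    show "pairing_character G \<beta> (y \<otimes>\<^bsub>H\<^esub> y') =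
        pairing_character G \<beta> y \<otimes>\<^bsub>character_group G\<^esub> pairing_character G \<beta> y'"
      if "y \<in> carrier H" "y' \<in> carrier H" for y y'
      using that
      by (auto simp: character_group_def pairing_character_def chi_mult_right fun_eq_iff simp flip: chi_def)
  qed
  show "bij_betw (pairing_character G \<beta>) (carrier H) (carrier (character_group G))"
    unfolding bij_betw_def
  proof
    show "inj_on (pairing_character G \<beta>) (carrier H)"
      by (rule inj_onI, rule chi_separates) (auto simp flip: pairing_character_eq)
    show "pairing_character G \<beta> ` carrier H = carrier (character_group G)"
    proof (intro equalityI subsetI)
      fix \<phi> assume \<phi>: "\<phi> \<in> carrier (character_group G)"
      obtain y where y: "y \<in> carrier H" "\<And>x. x \<in> carrier G \<Longrightarrow> \<phi> x = chi x y"
        using character_is_chi[OF \<phi>] by blast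
      have "\<phi> = pairing_character G \<beta> y"
      proof (rule extensionalityI)
        show "\<phi> \<in> extensional (carrier G)" using \<phi> by (simp add: character_group_def)
        show "pairing_character G \<beta> y \<in> extensional (carrier G)" by (simp add: pairing_character_def)
      qed (simp add: y pairing_character_eq)
      with y show "\<phi> \<in> pairing_character G \<beta> ` carrier H" by blast
    qed (auto intro: pairing_character_closed)
  qed
qed

end

section \<open>Dual partitions and their schemes\<close>

text \<open>\<open>P\<close> and \<open>Q\<close> enter only as tables of character sums; that they
  are eigenmatrices is derived below. The axioms are invariant under exchanging \<open>G\<close>,
  \<open>D\<close>, \<open>P\<close> with \<open>H\<close>, \<open>D'\<close>, \<open>Q\<close>, so
  the scheme on \<open>H\<close> needs no proof of its own.\<close>

locale dual_partitions = z4_pairing G H \<beta>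
  for G :: "('a, 'c) monoid_scheme" and H :: "('b, 'd) monoid_scheme" and \<beta> +
  fixes d :: nat and D :: "nat \<Rightarrow> 'a set" and D' :: "nat \<Rightarrow> 'b set" and P Q :: "nat \<Rightarrow> nat \<Rightarrow> real"
  assumes D_cover: "(\<Union>i\<le>d. D i) = carrier G" and D'_cover: "(\<Union>i\<le>d. D' i) = carrier H"
    and D_disjoint: "\<And>i j. i \<le> d \<Longrightarrow> j \<le> d \<Longrightarrow> i \<noteq> j \<Longrightarrow> D i \<inter> D j = {}"
    and D'_disjoint: "\<And>i j. i \<le> d \<Longrightarrow> j \<le> d \<Longrightarrow> i \<noteq> j \<Longrightarrow> D' i \<inter> D' j = {}"
    and D_nonempty: "\<And>i. i \<le> d \<Longrightarrow> D i \<noteq> {}" and D'_nonempty: "\<And>i. i \<le> d \<Longrightarrow> D' i \<noteq> {}"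
    and D_0: "D 0 = {\<one>\<^bsub>G\<^esub>}" and D'_0: "D' 0 = {\<one>\<^bsub>H\<^esub>}"
    and D_inv: "\<And>i x. i \<le> d \<Longrightarrow> x \<in> D i \<Longrightarrow> inv\<^bsub>G\<^esub> x \<in> D i"
    and D'_inv: "\<And>i y. i \<le> d \<Longrightarrow> y \<in> D' i \<Longrightarrow> inv\<^bsub>H\<^esub> y \<in> D' i"
    and Q_sum: "\<And>i j x. i \<le> d \<Longrightarrow> j \<le> d \<Longrightarrow> x \<in> D i \<Longrightarrow> (\<Sum>y\<in>D' j. chi x y) = of_real (Q i j)"
    and P_sum: "\<And>i j y. i \<le> d \<Longrightarrow> j \<le> d \<Longrightarrow> y \<in> D' i \<Longrightarrow> (\<Sum>x\<in>D j. chi x y) = of_real (P i j)"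
begin

lemma dual_partitions_flip: "dual_partitions H G (\<lambda>y x. \<beta> x y) d D' D Q P"
  by unfold_locales
    (simp_all add: D_cover D'_cover D_disjoint D'_disjoint D_nonempty D'_nonempty D_0 D'_0
      D_inv D'_inv Q_sum P_sum chi_flip)

lemma D_sub: "i \<le> d \<Longrightarrow> D i \<subseteq> carrier G" and D'_sub: "i \<le> d \<Longrightarrow> D' i \<subseteq> carrier H"
  using D_cover D'_cover by auto

lemma finite_D: "i \<le> d \<Longrightarrow> finite (D i)" and finite_D': "i \<le> d \<Longrightarrow> finite (D' i)"
  using D_sub D'_sub finite_G finite_H finite_subset by metis+

lemma sum_over_classes: "(\<Sum>i\<le>d. \<Sum>y\<in>D' i. f y) = (\<Sum>y\<in>carrier H. f y)"
  for f :: "'b \<Rightarrow> complex"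
  unfolding D'_cover[symmetric] using D'_disjoint finite_D'
  by (subst sum.UNION_disjoint) auto

lemma D_inv_iff: "i \<le> d \<Longrightarrow> x \<in> carrier G \<Longrightarrow> inv\<^bsub>G\<^esub> x \<in> D i \<longleftrightarrow> x \<in> D i"
  using D_inv[of i x] D_inv[of i "inv\<^bsub>G\<^esub> x"] by auto

section \<open>The idempotents and the two eigenmatrices\<close>

abbreviation "n \<equiv> card (carrier G)"

abbreviation "Rel i \<equiv> diff_rel G (D i)"

text \<open>The orthogonal projection onto the span of the characters \<open>chi _ y\<close> with
  \<open>y\<close> in \<open>D' j\<close>, written as a sum of projections of rank one. Character
  values have modulus 1, so \<open>inverse\<close> stands for complex conjugation.\<close>

definition idem :: "nat \<Rightarrow> 'a cmatrix"
  where "idem j x z = (if x \<in> carrier G \<and> z \<in> carrier G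
    then (\<Sum>y\<in>D' j. chi x y * inverse (chi z y)) / of_nat n else 0)"

text \<open>By orthogonality the characters are joint eigenvectors, with eigenvalue 1 or 0 according
  to their class. Both the products of the idempotents and the dual relations are read off from
  this.\<close>

lemma idem_mult_chi:
  assumes "j \<le> d" "x \<in> carrier G" "h \<in> carrier H"
  shows "(\<Sum>z\<in>carrier G. idem j x z * chi z h) = chi x h * of_bool (h \<in> D' j)"
proof -
  have "(\<Sum>z\<in>carrier G. idem j x z * chi z h) =
      (\<Sum>z\<in>carrier G. \<Sum>y\<in>D' j. chi x y / of_nat n * (chi z h * inverse (chi z y)))"
    using assms by (intro sum.cong refl) (simp add: idem_def sum_distrib_left sum_distrib_right sum_divide_distrib field_simps)
  also have "\<dots> = (\<Sum>y\<in>D' j. chi x y / of_nat n * (\<Sum>z\<in>carrier G. chi z h * inverse (chi z y)))"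
    by (subst sum.swap) (simp add: sum_distrib_left)
  also have "\<dots> = (\<Sum>y\<in>D' j. if y = h then chi x y else 0)"
    using assms D'_sub[of j] card_pos
    by (intro sum.cong refl) (auto simp: flip.sum_chi_right2)
  also have "\<dots> = chi x h * of_bool (h \<in> D' j)"
    using finite_D'[OF assms(1)] by (simp add: sum.delta)
  finally show ?thesis .
qed

lemma idem_mult_idem:
  assumes "i \<le> d" "j \<le> d"
  shows "cmat_mult (carrier G) (idem i) (idem j) = (if i = j then idem i else (\<lambda>x y. 0))"
proof (intro ext)
  fix x z
  show "cmat_mult (carrier G) (idem i) (idem j) x z = (if i = j then idem i else (\<lambda>x y. 0)) x z"
  proof (cases "x \<in> carrier G \<and> z \<in> carrier G")
    case True
    have "cmat_mult (carrier G) (idem i) (idem j) x z =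
        (\<Sum>w\<in>carrier G. \<Sum>y\<in>D' j. inverse (chi z y) / of_nat n * (idem i x w * chi w y))"
      unfolding cmat_mult_def using True
      by (intro sum.cong refl) (simp add: idem_def[of j] sum_distrib_left sum_divide_distrib field_simps)
    also have "\<dots> = (\<Sum>y\<in>D' j. inverse (chi z y) / of_nat n * (\<Sum>w\<in>carrier G. idem i x w * chi w y))"
      by (subst sum.swap) (simp add: sum_distrib_left)
    also have "\<dots> = (\<Sum>y\<in>D' j. inverse (chi z y) / of_nat n * (chi x y * of_bool (i = j)))"
      using True assms D'_sub[of j] D'_disjoint[of i j]
      by (intro sum.cong refl) (subst idem_mult_chi, auto)
    also have "\<dots> = (if i = j then idem i else (\<lambda>x y. 0)) x z"
      using True by (simp add: idem_def sum_divide_distrib mult.commute)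
    finally show ?thesis .
  qed (auto simp: cmat_mult_def idem_def)
qed

lemma idem_nonzero:
  assumes "j \<le> d"
  shows "idem j \<noteq> (\<lambda>x y. 0)"
proof
  assume "idem j = (\<lambda>x y. 0)"
  then have "idem j \<one>\<^bsub>G\<^esub> \<one>\<^bsub>G\<^esub> = 0" by simp
  moreover have "(\<Sum>y\<in>D' j. chi \<one>\<^bsub>G\<^esub> y * inverse (chi \<one>\<^bsub>G\<^esub> y)) = of_nat (card (D' j))"
    by simp
  ultimately show False
    using assms card_pos finite_D'[OF assms] D'_nonempty[OF assms]
    by (simp add: idem_def)
qed

lemma idem_0: "idem 0 = (\<lambda>x y. of_bool (x \<in> carrier G \<and> y \<in> carrier G) / of_nat n)"
  by (auto simp: fun_eq_iff idem_def D'_0)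

lemma second_eigenmatrix_idem: "second_eigenmatrix (carrier G) d Rel idem Q"
  unfolding second_eigenmatrix_def
proof (intro allI impI ext)
  fix j x z assume j: "j \<le> d"
  show "idem j x z = 1 / of_nat n * (\<Sum>i\<le>d. of_real (Q i j) * adjacency (Rel i) x z)"
  proof (cases "x \<in> carrier G \<and> z \<in> carrier G")
    case True
    define w where "w = x \<otimes>\<^bsub>G\<^esub> inv\<^bsub>G\<^esub> z"
    have w: "w \<in> carrier G" using True by (simp add: w_def)
    then obtain k where k: "k \<le> d" "w \<in> D k" using D_cover by auto
    have "(\<Sum>i\<le>d. of_real (Q i j) * adjacency (Rel i) x z) =
        (\<Sum>i\<le>d. if i = k then of_real (Q i j) else (0::complex))"
      using True k D_disjoint w_def
      by (intro sum.cong refl) (auto simp: adjacency_def diff_rel_def)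
    also have "\<dots> = of_real (Q k j)" using k by simp
    also have "\<dots> = (\<Sum>y\<in>D' j. chi w y)" using Q_sum[OF k(1) j k(2)] by simp
    also have "\<dots> = (\<Sum>y\<in>D' j. chi x y * inverse (chi z y))"
      using True D'_sub[OF j] by (intro sum.cong refl) (auto simp: w_def chi_mult_left chi_inv_left)
    finally show ?thesis using True by (simp add: idem_def)
  qed (auto simp: idem_def adjacency_def diff_rel_def)
qed

lemma first_eigenmatrix_idem: "first_eigenmatrix d Rel idem P"
  unfolding first_eigenmatrix_def
proof (intro allI impI ext)
  fix j x z assume j: "j \<le> d"
  show "adjacency (Rel j) x z = (\<Sum>i\<le>d. of_real (P i j) * idem i x z)"
  proof (cases "x \<in> carrier G \<and> z \<in> carrier G")
    case True
    then have xz: "x \<otimes>\<^bsub>G\<^esub> inv\<^bsub>G\<^esub> z \<in> carrier G" "z \<otimes>\<^bsub>G\<^esub> inv\<^bsub>G\<^esub> x \<in> carrier G"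
      "inv\<^bsub>G\<^esub> (x \<otimes>\<^bsub>G\<^esub> inv\<^bsub>G\<^esub> z) = z \<otimes>\<^bsub>G\<^esub> inv\<^bsub>G\<^esub> x"
      by (auto simp: G.inv_mult_group)
    \<comment> \<open>Replacing \<open>P i j\<close> by the character sum at \<open>y\<close> itself
      removes the dependence on the class \<open>i\<close>; the sum over classes then becomes one
      sum over \<open>H\<close>, to which orthogonality applies.\<close>
    have "(\<Sum>i\<le>d. of_real (P i j) * idem i x z) =
        (\<Sum>i\<le>d. \<Sum>y\<in>D' i. (\<Sum>w\<in>D j. chi w y) * (chi x y * inverse (chi z y)) / of_nat n)"
      using True P_sum[OF _ j]
      by (intro sum.cong refl) (simp add: idem_def sum_distrib_left sum_divide_distrib)
    also have "\<dots> = (\<Sum>y\<in>carrier H. (\<Sum>w\<in>D j. chi w y) * (chi x y * inverse (chi z y)) / of_nat n)"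
      by (rule sum_over_classes)
    also have "\<dots> = (\<Sum>y\<in>carrier H. \<Sum>w\<in>D j. chi w y * inverse (chi (z \<otimes>\<^bsub>G\<^esub> inv\<^bsub>G\<^esub> x) y) / of_nat n)"
      using True by (intro sum.cong refl)
        (simp add: chi_mult_left chi_inv_left sum_distrib_left sum_distrib_right sum_divide_distrib field_simps)
    also have "\<dots> = (\<Sum>w\<in>D j. (\<Sum>y\<in>carrier H. chi w y * inverse (chi (z \<otimes>\<^bsub>G\<^esub> inv\<^bsub>G\<^esub> x) y)) / of_nat n)"
      by (subst sum.swap) (simp add: sum_divide_distrib)
    also have "\<dots> = (\<Sum>w\<in>D j. if w = z \<otimes>\<^bsub>G\<^esub> inv\<^bsub>G\<^esub> x then 1 else 0)"
      using D_sub[OF j] xz card_pos card_eq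
      by (intro sum.cong refl) (subst sum_chi_right2, auto)
    also have "\<dots> = of_bool (z \<otimes>\<^bsub>G\<^esub> inv\<^bsub>G\<^esub> x \<in> D j)"
      using finite_D[OF j] by (simp add: sum.delta)
    \<comment> \<open>Orthogonality has selected the inverse of the quotient of \<open>x\<close> and
      \<open>z\<close>; closure of \<open>D j\<close> under inverses makes up for this.\<close>
    also have "\<dots> = adjacency (Rel j) x z"
      using True xz D_inv_iff[OF j, of "x \<otimes>\<^bsub>G\<^esub> inv\<^bsub>G\<^esub> z"] by (simp add: adjacency_def diff_rel_def)
    finally show ?thesis by simp
  qed (auto simp: idem_def adjacency_def diff_rel_def)
qed

section \<open>Primitive idempotents of the Bose-Mesner algebra\<close>

lemma bose_mesner_eq: "bose_mesner d Rel = {(\<lambda>x y. \<Sum>i\<le>d. c i * idem i x y) | c. True}"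
proof (intro equalityI subsetI)
  fix f assume "f \<in> bose_mesner d Rel"
  then obtain c where f: "f = (\<lambda>x y. \<Sum>j\<le>d. c j * adjacency (Rel j) x y)"
    by (auto simp: bose_mesner_def)
  have "f = (\<lambda>x y. \<Sum>i\<le>d. (\<Sum>j\<le>d. c j * of_real (P i j)) * idem i x y)"
  proof (intro ext)
    fix x y
    have "f x y = (\<Sum>j\<le>d. \<Sum>i\<le>d. c j * of_real (P i j) * idem i x y)"
      using first_eigenmatrix_idem unfolding f first_eigenmatrix_def
      by (simp add: sum_distrib_left mult.assoc)
    also have "\<dots> = (\<Sum>i\<le>d. (\<Sum>j\<le>d. c j * of_real (P i j)) * idem i x y)"
      by (subst sum.swap) (simp add: sum_distrib_right)
    finally show "f x y = \<dots>" .
  qed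
  then show "f \<in> {(\<lambda>x y. \<Sum>i\<le>d. c i * idem i x y) | c. True}"
    by (intro CollectI exI[of _ "\<lambda>i. \<Sum>j\<le>d. c j * of_real (P i j)"]) simp
next
  fix f assume "f \<in> {(\<lambda>x y. \<Sum>i\<le>d. c i * idem i x y) | c. True}"
  then obtain c where f: "f = (\<lambda>x y. \<Sum>j\<le>d. c j * idem j x y)" by auto
  have "f = (\<lambda>x y. \<Sum>i\<le>d. (\<Sum>j\<le>d. c j / of_nat n * of_real (Q i j)) * adjacency (Rel i) x y)"
  proof (intro ext)
    fix x y
    have "f x y = (\<Sum>j\<le>d. \<Sum>i\<le>d. c j / of_nat n * of_real (Q i j) * adjacency (Rel i) x y)"
      using second_eigenmatrix_idem unfolding f second_eigenmatrix_def
      by (simp add: sum_distrib_left mult.assoc)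
    also have "\<dots> = (\<Sum>i\<le>d. (\<Sum>j\<le>d. c j / of_nat n * of_real (Q i j)) * adjacency (Rel i) x y)"
      by (subst sum.swap) (simp add: sum_distrib_right)
    finally show "f x y = \<dots>" .
  qed
  then show "f \<in> bose_mesner d Rel"
    unfolding bose_mesner_def
    by (intro CollectI exI[of _ "\<lambda>i. \<Sum>j\<le>d. c j / of_nat n * of_real (Q i j)"]) simp
qed

text \<open>In coordinates with respect to \<open>idem\<close> the algebra is a product of copies of
  the complex field. Idempotents thereby become 0/1 vectors, and primitive ones the vectors with a
  single 1.\<close>

lemma idem_combination_mult:
  "cmat_mult (carrier G) (\<lambda>x y. \<Sum>i\<le>d. b i * idem i x y) (\<lambda>x y. \<Sum>i\<le>d. c i * idem i x y) =
    (\<lambda>x y. \<Sum>i\<le>d. b i * c i * idem i x y)"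
proof (intro ext)
  fix x y
  have "cmat_mult (carrier G) (\<lambda>x y. \<Sum>i\<le>d. b i * idem i x y) (\<lambda>x y. \<Sum>i\<le>d. c i * idem i x y) x y =
      (\<Sum>z\<in>carrier G. \<Sum>i\<le>d. \<Sum>j\<le>d. b i * c j * (idem i x z * idem j z y))"
    unfolding cmat_mult_def sum_product by (intro sum.cong refl) simp
  also have "\<dots> = (\<Sum>i\<le>d. \<Sum>j\<le>d. b i * c j * cmat_mult (carrier G) (idem i) (idem j) x y)"
    unfolding cmat_mult_def sum_distrib_left
    by (subst sum.swap) (intro sum.cong refl sum.swap)
  also have "\<dots> = (\<Sum>i\<le>d. \<Sum>j\<le>d. if j = i then b i * c i * idem i x y else 0)"
    by (intro sum.cong refl) (auto simp: idem_mult_idem)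
  finally show "cmat_mult (carrier G) (\<lambda>x y. \<Sum>i\<le>d. b i * idem i x y)
      (\<lambda>x y. \<Sum>i\<le>d. c i * idem i x y) x y = (\<Sum>i\<le>d. b i * c i * idem i x y)"
    by simp
qed

lemma idem_eq_combination:
  "k \<le> d \<Longrightarrow> idem k = (\<lambda>x y. \<Sum>i\<le>d. of_bool (i = k) * idem i x y)"
  by (simp add: fun_eq_iff of_bool_def if_distrib[of "\<lambda>c. c * _"] sum.delta cong: if_cong)

text \<open>Linear independence: multiplication by \<open>idem k\<close> isolates the
  \<open>k\<close>-th coefficient.\<close>

lemma idem_combination_eqD:
  assumes eq: "(\<lambda>x y. \<Sum>i\<le>d. b i * idem i x y) = (\<lambda>x y. \<Sum>i\<le>d. c i * idem i x y)" and k: "k \<le> d"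
  shows "b k = c k"
proof -
  have 1: "cmat_mult (carrier G) (idem k) (\<lambda>x y. \<Sum>i\<le>d. a i * idem i x y) = (\<lambda>x y. a k * idem k x y)" for a
  proof (intro ext)
    fix x y
    have "cmat_mult (carrier G) (idem k) (\<lambda>x y. \<Sum>i\<le>d. a i * idem i x y) x y =
        (\<Sum>i\<le>d. of_bool (i = k) * a i * idem i x y)"
      by (subst idem_eq_combination[OF k], subst idem_combination_mult) simp
    also have "\<dots> = (\<Sum>i\<le>d. if i = k then a k * idem k x y else 0)"
      by (intro sum.cong refl) auto
    finally show "cmat_mult (carrier G) (idem k) (\<lambda>x y. \<Sum>i\<le>d. a i * idem i x y) x y = a k * idem k x y"
      using k by simp
  qed
  have "(\<lambda>x y. b k * idem k x y) = (\<lambda>x y. c k * idem k x y)"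
    using 1[of b] 1[of c] eq by simp
  moreover obtain x y where "idem k x y \<noteq> 0" using idem_nonzero[OF k] by (meson ext)
  ultimately show ?thesis by (metis mult_cancel_right)
qed

lemma idempotent_iff:
  "cmat_mult (carrier G) (\<lambda>x y. \<Sum>i\<le>d. c i * idem i x y) (\<lambda>x y. \<Sum>i\<le>d. c i * idem i x y) =
      (\<lambda>x y. \<Sum>i\<le>d. c i * idem i x y) \<longleftrightarrow> (\<forall>i\<le>d. c i = 0 \<or> c i = 1)"
  unfolding idem_combination_mult
proof
  assume eq: "(\<lambda>x y. \<Sum>i\<le>d. c i * c i * idem i x y) = (\<lambda>x y. \<Sum>i\<le>d. c i * idem i x y)"
  show "\<forall>i\<le>d. c i = 0 \<or> c i = 1"
    using idem_combination_eqD[OF eq] by simp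
next
  assume "\<forall>i\<le>d. c i = 0 \<or> c i = 1"
  then have "c i * c i = c i" if "i \<le> d" for i using that by auto
  then show "(\<lambda>x y. \<Sum>i\<le>d. c i * c i * idem i x y) = (\<lambda>x y. \<Sum>i\<le>d. c i * idem i x y)"
    by (intro ext sum.cong refl) (simp del: mult_cancel_right1 mult_cancel_right2 mult_cancel_left1 mult_cancel_left2)
qed

lemma idem_in_bose_mesner: "k \<le> d \<Longrightarrow> idem k \<in> bose_mesner d Rel"
  unfolding bose_mesner_eq
  by (intro CollectI exI[of _ "\<lambda>i. of_bool (i = k)"] conjI TrueI idem_eq_combination)

lemma primitive_idem:
  assumes k: "k \<le> d"
  shows "primitive_idempotent (carrier G) d Rel (idem k)"
  unfolding primitive_idempotent_def
proof (intro conjI ballI impI)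
  show "cmat_mult (carrier G) (idem k) (idem k) = idem k"
    using k by (simp add: idem_mult_idem)
  fix f assume "f \<in> bose_mesner d Rel"
    and f: "cmat_mult (carrier G) f f = f \<and> cmat_mult (carrier G) (idem k) f = f"
  then obtain c where c: "f = (\<lambda>x y. \<Sum>i\<le>d. c i * idem i x y)" by (auto simp: bose_mesner_eq)
  have c01: "c i = 0 \<or> c i = 1" if "i \<le> d" for i
    using f that unfolding c idempotent_iff by blast
  have "cmat_mult (carrier G) (idem k) f = (\<lambda>x y. \<Sum>i\<le>d. of_bool (i = k) * c i * idem i x y)"
    using idem_combination_mult[of "\<lambda>i. of_bool (i = k)" c]
    unfolding c idem_eq_combination[OF k, symmetric] .
  with f have "(\<lambda>x y. \<Sum>i\<le>d. of_bool (i = k) * c i * idem i x y) = (\<lambda>x y. \<Sum>i\<le>d. c i * idem i x y)"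
    unfolding c by argo
  note c_eq = idem_combination_eqD[OF this]
  have c0: "c i = 0" if "i \<le> d" "i \<noteq> k" for i
    using c_eq[OF that(1)] that(2) by simp
  have "f = (\<lambda>x y. c k * idem k x y)"
  proof (intro ext)
    fix x y
    have "f x y = (\<Sum>i\<le>d. if i = k then c k * idem k x y else 0)"
      unfolding c by (intro sum.cong refl) (auto simp: c0)
    then show "f x y = c k * idem k x y" using k by simp
  qed
  then show "f = (\<lambda>x y. 0) \<or> f = idem k" using c01[OF k] by auto
qed (use k in \<open>simp_all add: idem_in_bose_mesner idem_nonzero\<close>)

text \<open>A nonzero 0/1 combination has some coefficient 1, so it fixes the corresponding
  \<open>idem k\<close> under multiplication; minimality then leaves only equality.\<close>

lemma primitive_idempotent_is_idem:
  assumes e: "primitive_idempotent (carrier G) d Rel e"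
  shows "\<exists>k\<le>d. e = idem k"
proof -
  obtain c where c: "e = (\<lambda>x y. \<Sum>i\<le>d. c i * idem i x y)"
    using e by (auto simp: primitive_idempotent_def bose_mesner_eq)
  have c01: "\<forall>i\<le>d. c i = 0 \<or> c i = 1"
    using e by (simp add: primitive_idempotent_def c idempotent_iff)
  obtain k where k: "k \<le> d" "c k \<noteq> 0"
  proof (rule ccontr)
    assume "\<not> thesis"
    then have "e = (\<lambda>x y. 0)" unfolding c using that by (intro ext sum.neutral) auto
    with e show False by (simp add: primitive_idempotent_def)
  qed
  have "cmat_mult (carrier G) e (idem k) = idem k"
  proof -
    have "cmat_mult (carrier G) e (idem k) = (\<lambda>x y. \<Sum>i\<le>d. c i * of_bool (i = k) * idem i x y)"
      using idem_combination_mult[of c "\<lambda>i. of_bool (i = k)"]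
      unfolding c idem_eq_combination[OF k(1), symmetric] .
    also have "\<dots> = (\<lambda>x y. \<Sum>i\<le>d. of_bool (i = k) * idem i x y)"
      using c01 k by (intro ext sum.cong) auto
    finally show ?thesis unfolding idem_eq_combination[OF k(1), symmetric] .
  qed
  moreover have "cmat_mult (carrier G) (idem k) (idem k) = idem k"
    using k by (simp add: idem_mult_idem)
  ultimately have "idem k = (\<lambda>x y. 0) \<or> idem k = e"
    using e idem_in_bose_mesner[OF k(1)] unfolding primitive_idempotent_def by blast
  with idem_nonzero[OF k(1)] have "e = idem k" by blast
  with k show ?thesis by blast
qed

lemma idempotent_ordering_idem: "idempotent_ordering (carrier G) d Rel idem"
  unfolding idempotent_ordering_def
proof
  have "inj_on idem {..d}"
  proof (rule inj_onI)
    fix i j assume ij: "i \<in> {..d}" "j \<in> {..d}" "idem i = idem j"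
    then show "i = j"
      using idem_mult_idem[of i j] idem_mult_idem[of i i] idem_nonzero[of i] by (metis atMost_iff)
  qed
  moreover have "idem ` {..d} = {e. primitive_idempotent (carrier G) d Rel e}"
  proof (intro equalityI subsetI)
    fix e assume "e \<in> {e. primitive_idempotent (carrier G) d Rel e}"
    then obtain k where "k \<le> d" "e = idem k" using primitive_idempotent_is_idem by blast
    then show "e \<in> idem ` {..d}" by blast
  qed (use primitive_idem in blast)
  ultimately show "bij_betw idem {..d} {e. primitive_idempotent (carrier G) d Rel e}"
    by (simp add: bij_betw_def)
qed (rule idem_0)

text \<open>The count is an entry of a product of two adjacency matrices. It is expanded in
  idempotents, whose entries are given by \<open>Q\<close>. The right-hand side depends on
  \<open>x\<close> and \<open>y\<close> only through \<open>k\<close>, which is the regularity axiom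
  of an association scheme.\<close>

lemma intersection_number_eq:
  assumes "k \<le> d" "(x, y) \<in> Rel k" "i \<le> d" "j \<le> d"
  shows "of_nat (card {z \<in> carrier G. (x, z) \<in> Rel i \<and> (z, y) \<in> Rel j}) =
    (\<Sum>l\<le>d. of_real (P l i) * of_real (P l j) * (of_real (Q k l) / of_nat n) :: complex)"
proof -
  have "{z \<in> carrier G. (x, z) \<in> Rel i \<and> (z, y) \<in> Rel j} =
      carrier G \<inter> {z. (x, z) \<in> Rel i \<and> (z, y) \<in> Rel j}" by blast
  then have "of_nat (card {z \<in> carrier G. (x, z) \<in> Rel i \<and> (z, y) \<in> Rel j}) =
      (\<Sum>z\<in>carrier G. of_bool ((x, z) \<in> Rel i \<and> (z, y) \<in> Rel j) :: complex)"
    by (subst sum_of_bool_eq) (simp_all only: finite_G)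
  also have "\<dots> = (\<Sum>z\<in>carrier G. adjacency (Rel i) x z * adjacency (Rel j) z y)"
    by (simp only: adjacency_def of_bool_conj)
  also have "\<dots> = cmat_mult (carrier G) (\<lambda>x y. \<Sum>l\<le>d. of_real (P l i) * idem l x y)
      (\<lambda>x y. \<Sum>l\<le>d. of_real (P l j) * idem l x y) x y"
    using first_eigenmatrix_idem assms by (simp add: cmat_mult_def first_eigenmatrix_def)
  also have "\<dots> = (\<Sum>l\<le>d. of_real (P l i) * of_real (P l j) * idem l x y)"
    by (simp add: idem_combination_mult)
  also have "\<dots> = (\<Sum>l\<le>d. of_real (P l i) * of_real (P l j) * (of_real (Q k l) / of_nat n))"
  proof (intro sum.cong refl)
    fix l assume l: "l \<in> {..d}"
    have "idem l x y = 1 / of_nat n * (\<Sum>a\<le>d. of_real (Q a l) * adjacency (Rel a) x y)"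
      using second_eigenmatrix_idem l by (simp add: second_eigenmatrix_def)
    also have "(\<Sum>a\<le>d. of_real (Q a l) * adjacency (Rel a) x y) =
        (\<Sum>a\<le>d. if a = k then of_real (Q k l) else 0 :: complex)"
      using assms D_disjoint[of k]
      by (intro sum.cong refl) (auto simp: adjacency_def diff_rel_def)
    finally show "of_real (P l i) * of_real (P l j) * idem l x y =
        of_real (P l i) * of_real (P l j) * (of_real (Q k l) / of_nat n)"
      using assms(1) by simp
  qed
  finally show ?thesis .
qed

lemma abelian_scheme_Rel: "abelian_scheme G d Rel"
  unfolding abelian_scheme_def association_scheme_def
proof (intro conjI allI impI)
  show "comm_group G" by (rule G.comm_group_axioms)
  show "finite (carrier G)" "carrier G \<noteq> {}" using finite_G by auto
  show "Rel 0 = Id_on (carrier G)"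
    by (auto simp: diff_rel_def D_0 G.inv_solve_right')
  show "(\<Union>i\<le>d. Rel i) = carrier G \<times> carrier G"
  proof (intro equalityI subsetI)
    fix p assume p: "p \<in> carrier G \<times> carrier G"
    then have "fst p \<otimes>\<^bsub>G\<^esub> inv\<^bsub>G\<^esub> snd p \<in> (\<Union>i\<le>d. D i)" unfolding D_cover by auto
    with p show "p \<in> (\<Union>i\<le>d. Rel i)" by (auto simp: diff_rel_def)
  qed (auto simp: diff_rel_def)
  show "Rel i \<noteq> {}" if i: "i \<le> d" for i
  proof -
    obtain x where "x \<in> D i" using D_nonempty[OF i] by blast
    then have "(x, \<one>\<^bsub>G\<^esub>) \<in> Rel i" using D_sub[OF i] by (auto simp: diff_rel_def)
    then show ?thesis by blast
  qed
  show "Rel i \<inter> Rel j = {}" if "i \<le> d" "j \<le> d" "i \<noteq> j" for i j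
    using D_disjoint[OF that] by (auto simp: diff_rel_def)
  show "sym (Rel i)" if i: "i \<le> d" for i
  proof (rule symI)
    fix x y assume "(x, y) \<in> Rel i"
    then have xy: "x \<in> carrier G" "y \<in> carrier G" "x \<otimes>\<^bsub>G\<^esub> inv\<^bsub>G\<^esub> y \<in> D i" by (auto simp: diff_rel_def)
    then have "inv\<^bsub>G\<^esub> (x \<otimes>\<^bsub>G\<^esub> inv\<^bsub>G\<^esub> y) \<in> D i" using D_inv[OF i] by blast
    with xy show "(y, x) \<in> Rel i" by (simp add: diff_rel_def G.inv_mult_group)
  qed
  show "\<exists>p. \<forall>(x, y)\<in>Rel k. card {z \<in> carrier G. (x, z) \<in> Rel i \<and> (z, y) \<in> Rel j} = p"
    if ijk: "i \<le> d" "j \<le> d" "k \<le> d" for i j k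
  proof -
    have "card {z \<in> carrier G. (x, z) \<in> Rel i \<and> (z, y) \<in> Rel j} =
        card {z \<in> carrier G. (x', z) \<in> Rel i \<and> (z, y') \<in> Rel j}"
      if "(x, y) \<in> Rel k" "(x', y') \<in> Rel k" for x y x' y'
      by (rule of_nat_eq_iff[where 'a = complex, THEN iffD1], rule trans,
          rule intersection_number_eq[OF ijk(3) that(1) ijk(1,2)],
          rule sym, rule intersection_number_eq[OF ijk(3) that(2) ijk(1,2)])
    then show ?thesis by (cases "Rel k = {}") (blast, fast)
  qed
  show "\<forall>(x, y)\<in>Rel i. \<forall>z\<in>carrier G. (x \<otimes>\<^bsub>G\<^esub> z, y \<otimes>\<^bsub>G\<^esub> z) \<in> Rel i" if "i \<le> d" for i
  proof safe
    fix x y z assume "(x, y) \<in> Rel i" and z: "z \<in> carrier G"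
    then have xy: "x \<in> carrier G" "y \<in> carrier G" "x \<otimes>\<^bsub>G\<^esub> inv\<^bsub>G\<^esub> y \<in> D i" by (auto simp: diff_rel_def)
    have "(x \<otimes>\<^bsub>G\<^esub> z) \<otimes>\<^bsub>G\<^esub> inv\<^bsub>G\<^esub> (y \<otimes>\<^bsub>G\<^esub> z) = x \<otimes>\<^bsub>G\<^esub> (z \<otimes>\<^bsub>G\<^esub> inv\<^bsub>G\<^esub> z) \<otimes>\<^bsub>G\<^esub> inv\<^bsub>G\<^esub> y"
      using xy z by (simp only: G.inv_mult_group G.m_assoc G.m_closed G.inv_closed)
    with xy z show "(x \<otimes>\<^bsub>G\<^esub> z, y \<otimes>\<^bsub>G\<^esub> z) \<in> Rel i" by (simp add: diff_rel_def)
  qed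
qed

section \<open>The dual scheme\<close>

lemma pairing_character_quotient:
  assumes "y \<in> carrier H" "y' \<in> carrier H"
  shows "pairing_character G \<beta> y \<otimes>\<^bsub>character_group G\<^esub> inv\<^bsub>character_group G\<^esub> pairing_character G \<beta> y' =
    pairing_character G \<beta> (y \<otimes>\<^bsub>H\<^esub> inv\<^bsub>H\<^esub> y')"
proof -
  interpret character: group "character_group G"
  \<comment> \<open>The group laws, and in particular inverses of characters, are transported from
    \<open>H\<close> along the isomorphism.\<close>
  proof (rule H.iso_imp_group)
    show "H \<cong> character_group G" using pairing_character_iso by (auto simp: is_iso_def)
  next
    show "Group.monoid (character_group G)"
      by (rule monoidI) (auto simp: character_group_def extensional_def fun_eq_iff)
  qed
  interpret hom: group_hom H "character_group G" "pairing_character G \<beta>"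
    by unfold_locales (use pairing_character_iso in \<open>simp add: iso_def\<close>)
  show ?thesis using assms by simp
qed

text \<open>By \<open>idem_mult_chi\<close> the character of \<open>h\<close> lies in the column
  space of \<open>idem j\<close> exactly when \<open>h\<close> is in \<open>D' j\<close>; this is
  applied to the quotient of two elements of \<open>H\<close>.\<close>

lemma dual_scheme_via_idem:
  "dual_scheme_via G idem H d (\<lambda>j. diff_rel H (D' j)) \<beta>"
  unfolding dual_scheme_via_def
proof (intro conjI allI impI ballI)
  fix j y y' assume j: "j \<le> d" and y: "y \<in> carrier H" "y' \<in> carrier H"
  define h where "h = y \<otimes>\<^bsub>H\<^esub> inv\<^bsub>H\<^esub> y'"
  have h: "h \<in> carrier H" using y by (simp add: h_def)
  have "(\<Sum>z\<in>carrier G. idem j x z * pairing_character G \<beta> h z) = chi x h * of_bool (h \<in> D' j)"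
    if "x \<in> carrier G" for x
    using idem_mult_chi[OF j that h] by (simp add: pairing_character_eq)
  then have "(\<forall>x\<in>carrier G. (\<Sum>z\<in>carrier G. idem j x z * pairing_character G \<beta> h z) =
      pairing_character G \<beta> h x) \<longleftrightarrow> (\<forall>x\<in>carrier G. chi x h * of_bool (h \<in> D' j) = chi x h)"
    by (simp add: pairing_character_eq)
  also have "\<dots> \<longleftrightarrow> h \<in> D' j"
    using G.one_closed by (auto simp: of_bool_def)
  finally have iff: "(\<forall>x\<in>carrier G. (\<Sum>z\<in>carrier G. idem j x z * pairing_character G \<beta> h z) =
      pairing_character G \<beta> h x) \<longleftrightarrow> h \<in> D' j" .
  show "(y, y') \<in> diff_rel H (D' j) \<longleftrightarrow>
      (pairing_character G \<beta> y, pairing_character G \<beta> y') \<in> dual_relation G idem j"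
    unfolding dual_relation_def diff_rel_def
    using y h iff by (simp add: pairing_character_closed pairing_character_quotient flip: h_def)
qed (rule nondegenerate pairing_character_iso)+

end

text \<open>
  The character sums over the classes \<open>D' j\<close> determine those over the classes \<open>D j\<close>: since
  \<open>Q P = n I\<close>, the indicator function of \<open>D j\<close> is a combination of the sums over the \<open>D' k\<close>,
  and its Fourier transform is then read off from orthogonality.
\<close>

lemma (in z4_pairing) dual_partitionsI:
  fixes P Q :: "nat \<Rightarrow> nat \<Rightarrow> real"
  assumes D_cover: "(\<Union>i\<le>d. D i) = carrier G" and D'_cover: "(\<Union>i\<le>d. D' i) = carrier H"
    and D_disjoint: "\<And>i j. i \<le> d \<Longrightarrow> j \<le> d \<Longrightarrow> i \<noteq> j \<Longrightarrow> D i \<inter> D j = {}"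
    and D'_disjoint: "\<And>i j. i \<le> d \<Longrightarrow> j \<le> d \<Longrightarrow> i \<noteq> j \<Longrightarrow> D' i \<inter> D' j = {}"
    and D_0: "D 0 = {\<one>\<^bsub>G\<^esub>}" and D'_0: "D' 0 = {\<one>\<^bsub>H\<^esub>}"
    and D_inv: "\<And>i x. i \<le> d \<Longrightarrow> x \<in> D i \<Longrightarrow> inv\<^bsub>G\<^esub> x \<in> D i"
    and D'_inv: "\<And>i y. i \<le> d \<Longrightarrow> y \<in> D' i \<Longrightarrow> inv\<^bsub>H\<^esub> y \<in> D' i"
    and Q_sum: "\<And>i j x. i \<le> d \<Longrightarrow> j \<le> d \<Longrightarrow> x \<in> D i \<Longrightarrow> (\<Sum>y\<in>D' j. chi x y) = of_real (Q i j)"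
    and QP: "\<And>i j. i \<le> d \<Longrightarrow> j \<le> d \<Longrightarrow>
      (\<Sum>k\<le>d. Q i k * P k j) = (if i = j then real (card (carrier G)) else 0)"
    and P_pos: "\<And>j. j \<le> d \<Longrightarrow> P 0 j \<noteq> 0" and Q_pos: "\<And>j. j \<le> d \<Longrightarrow> Q 0 j \<noteq> 0"
  shows "dual_partitions G H \<beta> d D D' P Q"
proof -
  have D_sub: "D i \<subseteq> carrier G" and D'_sub: "D' i \<subseteq> carrier H" if "i \<le> d" for i
    using D_cover D'_cover that by auto
  have P_sum: "(\<Sum>x\<in>D j. chi x y) = of_real (P i j)" if i: "i \<le> d" and j: "j \<le> d" and y: "y \<in> D' i" for i j y
  proof -
    define n where "n = card (carrier G)"
    have n: "n > 0" using card_pos by (simp add: n_def)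
    have yH: "y \<in> carrier H" using y D'_sub[OF i] by blast
    have indicator: "of_nat n * of_bool (x \<in> D j) =
        (\<Sum>k\<le>d. of_real (P k j) * (\<Sum>y'\<in>D' k. chi x y'))" if x: "x \<in> carrier G" for x
    proof -
      obtain a where a: "a \<le> d" "x \<in> D a" using x D_cover by auto
      have "(\<Sum>k\<le>d. of_real (P k j) * (\<Sum>y'\<in>D' k. chi x y')) =
          of_real (\<Sum>k\<le>d. Q a k * P k j)"
        unfolding of_real_sum by (intro sum.cong refl) (simp add: Q_sum[OF a(1) _ a(2)])
      also have "\<dots> = of_nat n * of_bool (x \<in> D j)"
        using QP[OF a(1) j] D_disjoint[OF a(1) j] a by (auto simp: n_def)
      finally show ?thesis by simp
    qed
    have "of_nat n * (\<Sum>x\<in>D j. chi x y) = (\<Sum>x\<in>carrier G. of_nat n * of_bool (x \<in> D j) * chi x y)"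
      unfolding sum_distrib_left
      by (rule sum.mono_neutral_cong_left) (use finite_G D_sub[OF j] in auto)
    also have "\<dots> = (\<Sum>x\<in>carrier G. \<Sum>k\<le>d. of_real (P k j) * (\<Sum>y'\<in>D' k. chi x y' * chi x y))"
      by (intro sum.cong refl) (simp add: indicator sum_distrib_right mult.assoc)
    also have "\<dots> = (\<Sum>k\<le>d. of_real (P k j) * (\<Sum>y'\<in>D' k. \<Sum>x\<in>carrier G. chi x y' * chi x y))"
      by (subst sum.swap) (simp add: sum.swap[of _ "carrier G"] flip: sum_distrib_left)
    also have "\<dots> = (\<Sum>k\<le>d. of_real (P k j) * (of_nat n * of_bool (i = k)))"
    proof (intro sum.cong refl arg_cong2[where f = "(*)"])
      fix k assume "k \<in> {..d}"
      then have k: "k \<le> d" by simp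
      \<comment> \<open>Here \<open>chi x y\<close> is not conjugated, so orthogonality selects the
        inverse of \<open>y\<close>, which lies in the same class as \<open>y\<close>.\<close>
      have "(\<Sum>y'\<in>D' k. \<Sum>x\<in>carrier G. chi x y' * chi x y) =
          (\<Sum>y'\<in>D' k. if y' = inv\<^bsub>H\<^esub> y then of_nat n else 0)"
      proof (intro sum.cong refl)
        fix y' assume "y' \<in> D' k"
        then have y': "y' \<in> carrier H" using D'_sub[OF k] by blast
        have "(\<Sum>x\<in>carrier G. chi x y' * chi x y) = (\<Sum>x\<in>carrier G. chi x y' * inverse (chi x (inv\<^bsub>H\<^esub> y)))"
          using yH by (intro sum.cong refl) (simp add: chi_inv_right)
        also have "\<dots> = (if y' = inv\<^bsub>H\<^esub> y then of_nat n else 0)"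
          using yH y' by (subst flip.sum_chi_right2) (auto simp: n_def)
        finally show "(\<Sum>x\<in>carrier G. chi x y' * chi x y) = \<dots>" .
      qed
      also have "\<dots> = of_nat n * of_bool (inv\<^bsub>H\<^esub> y \<in> D' k)"
        using finite_subset[OF D'_sub[OF k] finite_H] by (simp add: sum.delta)
      also have "inv\<^bsub>H\<^esub> y \<in> D' k \<longleftrightarrow> i = k"
        using D'_inv[OF i y] D'_disjoint[OF i k] by auto
      finally show "(\<Sum>y'\<in>D' k. \<Sum>x\<in>carrier G. chi x y' * chi x y) = of_nat n * of_bool (i = k)" .
    qed
    also have "\<dots> = (\<Sum>k\<le>d. if k = i then of_nat n * of_real (P i j) else 0)"
      by (intro sum.cong refl) auto
    also have "\<dots> = of_nat n * of_real (P i j)"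
      using i by simp
    finally show ?thesis using n by simp
  qed
  \<comment> \<open>At the identity all characters are 1, so the first rows of \<open>Q\<close> and
    \<open>P\<close> are the class sizes. Nonzero entries there are what makes the classes
    nonempty.\<close>
  have D'_card: "of_nat (card (D' j)) = (of_real (Q 0 j) :: complex)" if "j \<le> d" for j
    using Q_sum[of 0 j "\<one>\<^bsub>G\<^esub>"] that D_0 D'_sub[OF that] by (simp add: subset_iff)
  have D_card: "of_nat (card (D j)) = (of_real (P 0 j) :: complex)" if "j \<le> d" for j
    using P_sum[of 0 j "\<one>\<^bsub>H\<^esub>"] that D'_0 D_sub[OF that] by (simp add: subset_iff)
  have nonempty: "D j \<noteq> {}" "D' j \<noteq> {}" if "j \<le> d" for j
    using D_card[OF that] D'_card[OF that] P_pos[OF that] Q_pos[OF that] by auto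
  show ?thesis
    by unfold_locales
      (rule D_cover D'_cover D_0 D'_0 | erule nonempty | erule (1) D_inv D'_inv
        | erule (2) D_disjoint D'_disjoint Q_sum P_sum)+
qed

section \<open>Quadratic forms with values in the integers modulo 4\<close>

declare add_bit_eq_xor [simp del] mult_bit_eq_and [simp del] minus_bit_def [simp del]

lemma lift4_simps [simp]: "lift4 0 = 0" "lift4 1 = 1"
  by (simp_all add: lift4_def)

lemma twice_twice_Z4: "2 * (2 * a) = (0 :: 4)"
proof -
  have "(2 * 2 :: 4) = 0" by simp
  then show ?thesis by (metis mult.assoc mult_zero_left)
qed

text \<open>The lift itself is not additive, since 1 + 1 lifts to 0. Doubling kills the carry:
  \<open>2 * lift4\<close> embeds the additive group of the binary field as the subgroup {0,
  2}.\<close>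

lemma twice_lift4_add: "2 * lift4 (a + b) = 2 * lift4 a + 2 * lift4 b"
  by (cases a; cases b) simp_all

lemma twice_lift4_diff: "2 * lift4 a - 2 * lift4 b = 2 * lift4 (a - b)"
  using twice_lift4_add[of "a - b" b] by simp

lemma lift4_mult: "lift4 (a * b) = lift4 a * lift4 b"
  by (cases a; cases b) simp_all

text \<open>A square modulo 4 depends only on the residue modulo 2, so the lifted sum may be
  replaced by the sum of the lifts.\<close>

lemma lift4_add_square: "(lift4 (a + b))\<^sup>2 = (lift4 a)\<^sup>2 + (lift4 b)\<^sup>2 + 2 * (lift4 a * lift4 b)"
  by (cases a; cases b) simp_all

lemma twice_lift4_sum: "2 * lift4 (\<Sum>x\<in>A. f x) = 2 * (\<Sum>x\<in>A. lift4 (f x))"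
  by (induction A rule: infinite_finite_induct) (simp_all add: twice_lift4_add distrib_left)

lemma twice_lift4_eq_0_iff: "2 * lift4 a = 0 \<longleftrightarrow> a = 0"
  by (cases a) simp_all

section \<open>Polarization and the diagonal of a form\<close>

definition bdot :: "'m::finite bvec \<Rightarrow> 'm bvec \<Rightarrow> bit"
  where "bdot u v = (\<Sum>i\<in>UNIV. u $ i * v $ i)"

lemma bdot_commute: "bdot u v = bdot v u"
  by (simp add: bdot_def mult.commute)

lemma bdot_add_left: "bdot (u + v) w = bdot u w + bdot v w"
  by (simp add: bdot_def algebra_simps sum.distrib)

lemma bdot_add_right: "bdot u (v + w) = bdot u v + bdot u w"
  by (simp add: bdot_def algebra_simps sum.distrib)

lemma bdot_diff_right: "bdot u (v - w) = bdot u v - bdot u w"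
  using bdot_add_right[of u "v - w" w] by (simp add: eq_diff_eq)

lemma bdot_0 [simp]: "bdot 0 v = 0" "bdot v 0 = 0"
  by (simp_all add: bdot_def)

lemma bdot_axis: "bdot (axis k 1) v = v $ k" "bdot v (axis k 1) = v $ k"
  by (simp_all add: bdot_def axis_def if_distrib[of "\<lambda>x. x * _"] if_distrib[of "\<lambda>x. _ * x"] cong: if_cong)

lemma bdot_eq_0D: "(\<And>u. bdot u v = 0) \<Longrightarrow> v = 0"
  by (metis bdot_axis(1) vec_eq_iff zero_index)

text \<open>Brings a full bilinear sum into the shape of \<open>quad_form\<close>, diagonal terms
  plus pairs \<open>i < j\<close>.\<close>

lemma sum_split_diagonal:
  fixes f :: "'m::{finite,linorder} \<Rightarrow> 'm \<Rightarrow> 'a::comm_monoid_add"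
  shows "(\<Sum>i\<in>UNIV. \<Sum>j\<in>UNIV. f i j) =
    (\<Sum>i\<in>UNIV. f i i) + (\<Sum>i\<in>UNIV. \<Sum>j | i < j. f i j + f j i)"
proof -
  have "(\<Sum>j\<in>UNIV. f i j) = f i i + ((\<Sum>j | i < j. f i j) + (\<Sum>j | j < i. f i j))" for i
  proof -
    have U: "(UNIV :: 'm set) = insert i ({j. i < j} \<union> {j. j < i})" by auto
    show ?thesis unfolding U
      by (subst sum.insert) (auto intro!: sum.union_disjoint arg_cong2[where f = "(+)"])
  qed
  then have "(\<Sum>i\<in>UNIV. \<Sum>j\<in>UNIV. f i j) =
      (\<Sum>i\<in>UNIV. f i i) + ((\<Sum>i\<in>UNIV. \<Sum>j | i < j. f i j) + (\<Sum>i\<in>UNIV. \<Sum>j | j < i. f i j))"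
    by (simp add: sum.distrib)
  also have "(\<Sum>i\<in>UNIV. \<Sum>j | j < i. f i j) = (\<Sum>j\<in>UNIV. \<Sum>i | j < i. f i j)"
    using sum.swap_restrict[of "UNIV :: 'm set" "UNIV :: 'm set" f "\<lambda>i j. j < i"] by simp
  finally show ?thesis by (simp add: sum.distrib)
qed

lemma quad_form_0 [simp]: "quad_form R 0 = 0"
  by (simp add: quad_form_def)

lemma quad_form_zero_matrix [simp]: "quad_form 0 v = 0"
  by (simp add: quad_form_def)

text \<open>The squares on the diagonal contribute the cross terms \<open>2 u_i v_i\<close>, and
  each pair \<open>i < j\<close> contributes both mixed products; by symmetry these make up the full
  bilinear form. Off the diagonal the lift of \<open>u + v\<close> always occurs with a factor 2, so
  its carries do not matter.\<close>

lemma quad_form_add: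
  fixes R :: "bit^'m::{finite,linorder}^'m::{finite,linorder}"
  assumes sym: "Finite_Cartesian_Product.transpose R = R"
  shows "quad_form R (u + v) = quad_form R u + quad_form R v + 2 * lift4 (bdot u (R *v v))"
proof -
  define a where "a i j = lift4 (R $ i $ j)" for i j
  define x where "x i = lift4 (u $ i)" for i
  define y where "y i = lift4 (v $ i)" for i
  define z where "z i = lift4 ((u + v) $ i)" for i
  have a_sym: "a i j = a j i" for i j
    unfolding a_def using sym by (metis transpose_def vec_lambda_beta)
  have z2: "2 * z i = 2 * (x i + y i)" for i
    by (simp add: x_def y_def z_def twice_lift4_add distrib_left)
  have zz: "2 * (a i j * z i * z j) = 2 * (a i j * x i * x j) + 2 * (a i j * y i * y j) +
      2 * (a i j * x i * y j + a j i * x j * y i)" for i j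
  proof -
    have "2 * (a i j * z i * z j) = a i j * z i * (2 * z j)" by (simp add: mult.left_commute)
    also have "\<dots> = a i j * (2 * z i) * (x j + y j)" unfolding z2[of j] by (simp only: mult_ac)
    also have "\<dots> = 2 * (a i j * (x i + y i) * (x j + y j))" unfolding z2[of i] by (simp only: mult_ac)
    finally show ?thesis by (simp add: a_sym[of j i] algebra_simps)
  qed
  have "2 * lift4 (bdot u (R *v v)) = 2 * (\<Sum>i\<in>UNIV. \<Sum>j\<in>UNIV. a i j * x i * y j)"
  proof -
    have "bdot u (R *v v) = (\<Sum>i\<in>UNIV. \<Sum>j\<in>UNIV. R $ i $ j * u $ i * v $ j)"
      unfolding bdot_def matrix_vector_mult_def by (simp add: sum_distrib_left mult_ac)
    then have "2 * lift4 (bdot u (R *v v)) = 2 * (\<Sum>i\<in>UNIV. lift4 (\<Sum>j\<in>UNIV. R $ i $ j * u $ i * v $ j))"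
      by (simp add: twice_lift4_sum)
    also have "\<dots> = (\<Sum>i\<in>UNIV. 2 * (\<Sum>j\<in>UNIV. a i j * x i * y j))"
      unfolding sum_distrib_left[of 2 _ UNIV] twice_lift4_sum by (simp add: lift4_mult a_def x_def y_def)
    finally show ?thesis by (simp add: sum_distrib_left)
  qed
  also have "\<dots> = 2 * (\<Sum>i\<in>UNIV. a i i * x i * y i) +
      2 * (\<Sum>i\<in>UNIV. \<Sum>j | i < j. a i j * x i * y j + a j i * x j * y i)"
    by (subst sum_split_diagonal) (simp add: distrib_left)
  finally have B: "2 * lift4 (bdot u (R *v v)) = \<dots>" .
  have diag: "(\<Sum>i\<in>UNIV. a i i * (z i)\<^sup>2) =
      (\<Sum>i\<in>UNIV. a i i * (x i)\<^sup>2) + (\<Sum>i\<in>UNIV. a i i * (y i)\<^sup>2) + 2 * (\<Sum>i\<in>UNIV. a i i * x i * y i)"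
    by (simp add: z_def x_def y_def lift4_add_square sum_distrib_left flip: sum.distrib)
      (simp add: algebra_simps)
  have off: "2 * (\<Sum>i\<in>UNIV. \<Sum>j | i < j. a i j * z i * z j) =
      2 * (\<Sum>i\<in>UNIV. \<Sum>j | i < j. a i j * x i * x j) + 2 * (\<Sum>i\<in>UNIV. \<Sum>j | i < j. a i j * y i * y j) +
      2 * (\<Sum>i\<in>UNIV. \<Sum>j | i < j. a i j * x i * y j + a j i * x j * y i)"
    unfolding sum_distrib_left zz by (simp only: sum.distrib)
  have Q: "quad_form R (u + v) = (\<Sum>i\<in>UNIV. a i i * (z i)\<^sup>2) + 2 * (\<Sum>i\<in>UNIV. \<Sum>j | i < j. a i j * z i * z j)"
    "quad_form R u = (\<Sum>i\<in>UNIV. a i i * (x i)\<^sup>2) + 2 * (\<Sum>i\<in>UNIV. \<Sum>j | i < j. a i j * x i * x j)"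
    "quad_form R v = (\<Sum>i\<in>UNIV. a i i * (y i)\<^sup>2) + 2 * (\<Sum>i\<in>UNIV. \<Sum>j | i < j. a i j * y i * y j)"
    by (simp_all only: quad_form_def a_def x_def y_def z_def)
  show ?thesis unfolding Q diag off B by (simp only: add_ac)
qed

definition diag_vec :: "bit^'m^'m \<Rightarrow> 'm::finite bvec"
  where "diag_vec R = (\<chi> i. R $ i $ i)"

lemma diag_vec_diff: "diag_vec (R - R') = diag_vec R - diag_vec R'"
  by (simp add: diag_vec_def vec_eq_iff)

text \<open>Doubling removes the off-diagonal part, and squaring is the identity on {0, 1}. Modulo 2
  the form is therefore linear, with the diagonal as its coefficient vector.\<close>

lemma twice_quad_form: "2 * quad_form R v = 2 * lift4 (bdot (diag_vec R) v)"
proof -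
  have sq: "(lift4 b)\<^sup>2 = lift4 b" for b by (cases b) simp_all
  have "2 * quad_form R v = 2 * (\<Sum>i\<in>UNIV. lift4 (R $ i $ i) * lift4 (v $ i))"
    unfolding quad_form_def distrib_left twice_twice_Z4 sq by (simp only: add_0_right)
  also have "\<dots> = 2 * lift4 (bdot (diag_vec R) v)"
    by (simp add: bdot_def diag_vec_def twice_lift4_sum lift4_mult)
  finally show ?thesis .
qed

section \<open>Exponential sums of Kerdock words\<close>

definition kword ::
    "bit^'m::{finite,linorder}^'m::{finite,linorder} \<Rightarrow> 'm bvec \<Rightarrow> 4 \<Rightarrow> 'm bvec \<Rightarrow> 4"
  where "kword R s \<epsilon> v = quad_form R v + 2 * lift4 (bdot s v) + \<epsilon>"

lemma kerdock_words_eq: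
  fixes S :: "(bit^'m::{finite,linorder}^'m::{finite,linorder}) set"
  shows "kerdock_words S = {kword R s \<epsilon> | R s \<epsilon>. R \<in> S}"
proof -
  have "kword R s \<epsilon> = (\<lambda>v. quad_form R v + 2 * (\<Sum>i\<in>UNIV. lift4 (s $ i) * lift4 (v $ i)) + \<epsilon>)"
    for R :: "bit^'m::{finite,linorder}^'m::{finite,linorder}" and s \<epsilon>
    by (simp add: fun_eq_iff kword_def bdot_def twice_lift4_sum lift4_mult)
  then show ?thesis by (simp only: kerdock_words_def)
qed

lemma kword_add:
  assumes "Finite_Cartesian_Product.transpose R = R"
  shows "kword R s \<epsilon> (u + v) = kword R s \<epsilon> u + (quad_form R v + 2 * lift4 (bdot s v)) + 2 * lift4 (bdot u (R *v v))"
  by (simp add: kword_def quad_form_add[OF assms] bdot_add_right twice_lift4_add)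

section \<open>Character sums over the binary space\<close>

lemma UNIV_bit: "(UNIV :: bit set) = {0, 1}"
  using bit.exhaust by auto

instance bit :: finite
  by standard (simp add: UNIV_bit)

lemma CARD_bit: "CARD(bit) = 2"
  by (simp add: UNIV_bit)

lemma CARD_bvec: "CARD('m::finite bvec) = 2 ^ CARD('m)"
  by (simp add: CARD_bit)

lemma sum_translate:
  fixes f :: "'a::{ab_group_add,finite} \<Rightarrow> 'b::comm_monoid_add"
  shows "(\<Sum>v\<in>UNIV. f (v + w)) = (\<Sum>v\<in>UNIV. f v)"
  by (rule sum.reindex_bij_witness[where i = "\<lambda>v. v - w" and j = "\<lambda>v. v + w"]) auto

lemma sum_bdot_character:
  fixes w :: "'m::finite bvec"
  shows "(\<Sum>v\<in>UNIV. i_power (2 * lift4 (bdot v w))) = (if w = 0 then 2 ^ CARD('m) else 0)"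
proof (cases "w = 0")
  case True
  then show ?thesis by (simp add: CARD_bit)
next
  case False
  then obtain k where k: "w $ k \<noteq> 0" by (auto simp: vec_eq_iff)
  then have k1: "w $ k = 1" by simp
  have "(\<Sum>v\<in>UNIV. i_power (2 * lift4 (bdot v w))) = (\<Sum>v\<in>UNIV. i_power (2 * lift4 (bdot (v + axis k 1) w)))"
    by (rule sum_translate[symmetric])
  also have "\<dots> = - (\<Sum>v\<in>UNIV. i_power (2 * lift4 (bdot v w)))"
    by (simp add: bdot_add_left twice_lift4_add i_power_add bdot_axis k1 sum_negf)
  finally show ?thesis using False by simp
qed

definition exp_sum :: "('v::finite \<Rightarrow> 4) \<Rightarrow> complex"
  where "exp_sum x = (\<Sum>v\<in>UNIV. i_power (x v))"

text \<open>The classical evaluation of the modulus of a Gauss sum. In terms of the difference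
  \<open>w\<close> of the two summation variables, polarization turns the sum over \<open>v\<close>
  into that of the linear character given by \<open>R *v w\<close>, which vanishes unless
  \<open>w = 0\<close>.\<close>

lemma exp_sum_norm:
  fixes R :: "bit^'m::{finite,linorder}^'m::{finite,linorder}"
  assumes sym: "Finite_Cartesian_Product.transpose R = R" and inv: "invertible R"
  shows "exp_sum (kword R s \<epsilon>) * cnj (exp_sum (kword R s \<epsilon>)) = 2 ^ CARD('m)"
proof -
  let ?x = "kword R s \<epsilon>"
  let ?g = "\<lambda>w. i_power (quad_form R w + 2 * lift4 (bdot s w))"
  have "exp_sum ?x * cnj (exp_sum ?x) = (\<Sum>u\<in>UNIV. \<Sum>v\<in>UNIV. i_power (?x u - ?x v))"
    by (simp add: exp_sum_def sum_product i_power_diff)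
  also have "\<dots> = (\<Sum>v\<in>UNIV. \<Sum>w\<in>UNIV. i_power (?x (w + v) - ?x v))"
    by (subst sum.swap) (simp only: sum_translate[of "\<lambda>u. i_power (?x u - _)"])
  also have "\<dots> = (\<Sum>v\<in>UNIV. \<Sum>w\<in>UNIV. ?g w * i_power (2 * lift4 (bdot v (R *v w))))"
  proof (intro sum.cong refl)
    fix v w
    have "?x (w + v) - ?x v = (quad_form R w + 2 * lift4 (bdot s w)) + 2 * lift4 (bdot v (R *v w))"
      using kword_add[OF sym, of s \<epsilon> v w] by (simp add: add.commute)
    then show "i_power (?x (w + v) - ?x v) = ?g w * i_power (2 * lift4 (bdot v (R *v w)))"
      by (simp only: i_power_add)
  qed
  also have "\<dots> = (\<Sum>w\<in>UNIV. ?g w * (\<Sum>v\<in>UNIV. i_power (2 * lift4 (bdot v (R *v w)))))"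
    by (subst sum.swap) (simp add: sum_distrib_left)
  also have "\<dots> = (\<Sum>w\<in>(UNIV :: 'm bvec set). if w = 0 then 2 ^ CARD('m) else 0)"
  proof (intro sum.cong refl)
    fix w :: "'m bvec"
    have "R *v w = 0 \<longleftrightarrow> w = 0"
      using inv by (metis invertible_def matrix_left_invertible_ker matrix_vector_mult_0_right)
    then show "?g w * (\<Sum>v\<in>UNIV. i_power (2 * lift4 (bdot v (R *v w)))) = (if w = 0 then 2 ^ CARD('m) else 0)"
      by (simp add: sum_bdot_character)
  qed
  also have "\<dots> = 2 ^ CARD('m)" by simp
  finally show ?thesis .
qed

text \<open>Descent: \<open>a\<close> and \<open>b\<close> have equal parity, two odd squares would
  add up to 2 modulo 4, and halving both numbers lowers the exponent by 2. At the bottom, 2 can only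
  be 1 + 1.\<close>

lemma sum_two_squares_eq_odd_power_of_2:
  fixes a b :: int
  assumes "a\<^sup>2 + b\<^sup>2 = 2 ^ (2 * k + 1)"
  shows "a\<^sup>2 = 2 ^ (2 * k) \<and> b\<^sup>2 = 2 ^ (2 * k)"
  using assms
proof (induction k arbitrary: a b)
  case 0
  have "c\<^sup>2 = 0 \<or> c\<^sup>2 = 1 \<or> c\<^sup>2 \<ge> 4" for c :: int
  proof (cases "\<bar>c\<bar> \<le> 1")
    case True
    then have "c = 0 \<or> c = 1 \<or> c = -1" by auto
    then show ?thesis by auto
  next
    case False
    then have "\<bar>c\<bar>\<^sup>2 \<ge> 2\<^sup>2" by (intro power_mono) auto
    then show ?thesis by simp
  qed
  from this[of a] this[of b] 0 zero_le_power2[of a] zero_le_power2[of b] show ?case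
    by (auto simp del: zero_le_power2)
next
  case (Suc k)
  have "even (a\<^sup>2 + b\<^sup>2)" unfolding Suc.prems by simp
  then have par: "even a \<longleftrightarrow> even b" by simp
  have "even a"
  proof (rule ccontr)
    assume "odd a"
    then obtain c e where "a = 2 * c + 1" "b = 2 * e + 1" using par by (meson oddE)
    then have "a\<^sup>2 + b\<^sup>2 = 4 * (c\<^sup>2 + c + e\<^sup>2 + e) + 2" by (simp add: power2_eq_square algebra_simps)
    moreover have "(2::int) ^ (2 * Suc k + 1) = 4 * (2 * 2 ^ (2 * k))" by (simp add: power_add)
    ultimately have "4 * (c\<^sup>2 + c + e\<^sup>2 + e) + 2 = 4 * (2 * 2 ^ (2 * k))" using Suc.prems by simp
    then show False by presburger
  qed
  with par obtain c e where ce: "a = 2 * c" "b = 2 * e" by (meson evenE)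
  with Suc.prems have "c\<^sup>2 + e\<^sup>2 = 2 ^ (2 * k + 1)" by (simp add: power_mult_distrib power_add)
  from Suc.IH[OF this] ce show ?case by (simp add: power_mult_distrib)
qed

lemma exp_sum_gaussian:
  obtains a b :: int where "exp_sum x = Complex (of_int a) (of_int b)"
proof -
  have "Re (i_power c) \<in> \<int>" "Im (i_power c) \<in> \<int>" for c
    by (cases c rule: exhaust_Z4; simp)+
  then have "Re (exp_sum x) \<in> \<int>" "Im (exp_sum x) \<in> \<int>"
    by (auto simp: exp_sum_def intro!: Ints_sum)
  then obtain a b where "Re (exp_sum x) = of_int a" "Im (exp_sum x) = of_int b"
    by (auto elim!: Ints_cases)
  then show ?thesis using that[of a b] by (simp add: complex_eq_iff)
qed

lemma exp_sum_re_im: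
  fixes R :: "bit^'m::{finite,linorder}^'m::{finite,linorder}"
  assumes sym: "Finite_Cartesian_Product.transpose R = R" and inv: "invertible R"
    and odd: "odd CARD('m)"
  shows "(Re (exp_sum (kword R s \<epsilon>)))\<^sup>2 = 2 ^ (CARD('m) - 1)"
    and "(Im (exp_sum (kword R s \<epsilon>)))\<^sup>2 = 2 ^ (CARD('m) - 1)"
proof -
  obtain a b where ab: "exp_sum (kword R s \<epsilon>) = Complex (of_int a) (of_int b)"
    by (rule exp_sum_gaussian)
  obtain k where k: "CARD('m) = 2 * k + 1" using odd by (elim oddE)
  have "complex_of_real ((of_int a)\<^sup>2 + (of_int b)\<^sup>2) = of_real (2 ^ CARD('m))"
    using exp_sum_norm[OF sym inv, of s \<epsilon>] unfolding ab complex_mult_cnj by simp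
  then have "(of_int a)\<^sup>2 + (of_int b)\<^sup>2 = (2 ^ CARD('m) :: real)"
    by (simp only: of_real_eq_iff)
  then have "of_int (a\<^sup>2 + b\<^sup>2) = (of_int (2 ^ CARD('m)) :: real)" by simp
  then have "a\<^sup>2 + b\<^sup>2 = 2 ^ (2 * k + 1)" by (simp only: of_int_eq_iff k)
  from sum_two_squares_eq_odd_power_of_2[OF this]
  have "real_of_int (a\<^sup>2) = of_int (2 ^ (2 * k))" "real_of_int (b\<^sup>2) = of_int (2 ^ (2 * k))" by simp_all
  then show "(Re (exp_sum (kword R s \<epsilon>)))\<^sup>2 = 2 ^ (CARD('m) - 1)"
    "(Im (exp_sum (kword R s \<epsilon>)))\<^sup>2 = 2 ^ (CARD('m) - 1)"
    by (simp_all add: ab k)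
qed

text \<open>
  A form with zero diagonal is even, so its exponential sum is a rational integer; but the square
  of its modulus is an odd power of 2.
\<close>

lemma diag_vec_nonzero:
  fixes R :: "bit^'m::{finite,linorder}^'m::{finite,linorder}"
  assumes sym: "Finite_Cartesian_Product.transpose R = R" and inv: "invertible R"
    and odd: "odd CARD('m)"
  shows "diag_vec R \<noteq> 0"
proof
  assume "diag_vec R = 0"
  then have "2 * kword R 0 0 v = 0" for v
    by (simp add: kword_def twice_quad_form)
  moreover have "Im (i_power c) = 0" if "2 * c = 0" for c
    using that by (cases c rule: exhaust_Z4) auto
  ultimately have "Im (exp_sum (kword R 0 0)) = 0" by (simp add: exp_sum_def)
  with exp_sum_re_im(2)[OF assms, of 0 0] show False by simp
qed

text \<open>Up to a constant, the doubled word is a doubled linear form with the diagonal as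
  coefficients, hence balanced if the diagonal is nonzero.\<close>

lemma sum_twice_kword:
  fixes R :: "bit^'m::{finite,linorder}^'m::{finite,linorder}"
  assumes "diag_vec R \<noteq> 0"
  shows "(\<Sum>v\<in>UNIV. i_power (2 * kword R s \<epsilon> v)) = 0"
proof -
  have "2 * kword R s \<epsilon> v = 2 * lift4 (bdot v (diag_vec R)) + 2 * \<epsilon>" for v
    unfolding kword_def distrib_left twice_quad_form twice_twice_Z4 bdot_commute[of v]
    by (simp only: add_0_right)
  then have "(\<Sum>v\<in>UNIV. i_power (2 * kword R s \<epsilon> v)) =
      (\<Sum>v\<in>UNIV. i_power (2 * lift4 (bdot v (diag_vec R)))) * i_power (2 * \<epsilon>)"
    by (simp only: i_power_add sum_distrib_right)
  then show ?thesis using assms by (simp add: sum_bdot_character)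
qed

section \<open>Linear Kerdock codes\<close>

lemma carrier_word_group: "carrier (word_group I) = extensional I"
  by (auto simp: word_group_def product_group_def Z4_def PiE_def)

lemma mult_word_group: "x \<otimes>\<^bsub>word_group I\<^esub> y = (\<lambda>j\<in>I. x j + y j)"
  by (simp add: word_group_def product_group_def Z4_def)

lemma one_word_group: "\<one>\<^bsub>word_group I\<^esub> = (\<lambda>j\<in>I. 0)"
  by (simp add: word_group_def product_group_def Z4_def)

lemma comm_group_word_group: "comm_group (word_group I)"
  unfolding word_group_def
proof (rule group.group_comm_groupI)
  show "group (product_group I (\<lambda>_. Z4))"
    using comm_group_Z4 by (simp add: comm_group.axioms(2))
qed (simp add: product_group_def Z4_def add.commute)

lemma inv_word_group:
  assumes "x \<in> extensional I"
  shows "inv\<^bsub>word_group I\<^esub> x = (\<lambda>j\<in>I. - x j)"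
proof -
  interpret comm_group "word_group I" by (rule comm_group_word_group)
  show ?thesis
    using assms
    by (intro inv_equality) (auto simp: carrier_word_group mult_word_group one_word_group fun_eq_iff)
qed

lemma matrix_diff_vector_mult: "(A - B) *v x = A *v x - B *v x" for A B :: "bit^'n^'m"
  by (simp add: matrix_vector_mult_def vec_eq_iff left_diff_distrib sum_subtractf)

locale linear_kerdock =
  fixes S :: "(bit^'m::{finite,linorder}^'m::{finite,linorder}) set" and K :: "('m bvec \<Rightarrow> 4) set"
  assumes kerdock_set: "kerdock_set S"
    and K_eq: "K = kerdock_words S"
    and K_subgroup: "subgroup K (word_group UNIV)"
    and odd_m: "odd CARD('m)"
begin

lemma K_cases:
  assumes "x \<in> K"
  obtains R s \<epsilon> where "R \<in> S" "x = kword R s \<epsilon>"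
  using assms by (auto simp: K_eq kerdock_words_eq)

lemma kword_in_K: "R \<in> S \<Longrightarrow> kword R s \<epsilon> \<in> K"
  by (auto simp: K_eq kerdock_words_eq)

lemma K_zero: "(\<lambda>v. 0) \<in> K"
  using subgroup.one_closed[OF K_subgroup] by (simp add: one_word_group restrict_def)

lemma K_add: "x \<in> K \<Longrightarrow> y \<in> K \<Longrightarrow> (\<lambda>v. x v + y v) \<in> K"
  using subgroup.m_closed[OF K_subgroup, of x y] by (simp add: mult_word_group restrict_def)

lemma K_uminus: "x \<in> K \<Longrightarrow> (\<lambda>v. - x v) \<in> K"
  using subgroup.m_inv_closed[OF K_subgroup, of x] by (simp add: inv_word_group restrict_def)

lemma S_sym: "R \<in> S \<Longrightarrow> Finite_Cartesian_Product.transpose R = R"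
  using kerdock_set by (simp add: kerdock_set_def)

lemma S_diff_sym:
  assumes "R \<in> S" "R' \<in> S"
  shows "Finite_Cartesian_Product.transpose (R - R') = R - R'"
  using S_sym[OF assms(1)] S_sym[OF assms(2)] by (simp add: transpose_def vec_eq_iff)

lemma S_diff_invertible: "R \<in> S \<Longrightarrow> R' \<in> S \<Longrightarrow> R \<noteq> R' \<Longrightarrow> invertible (R - R')"
  using kerdock_set by (simp add: kerdock_set_def)

lemma card_S: "card S = CARD('m bvec)"
  using kerdock_set by (simp add: kerdock_set_def CARD_bit)

text \<open>The zero word must come from some form, and polarization forces its matrix to vanish.
  Consequently every other matrix in \<open>S\<close>, being a difference with 0, is itself
  nonsingular.\<close>

lemma zero_in_S: "0 \<in> S"
proof -
  obtain R s \<epsilon> where R: "R \<in> S" and zero: "(\<lambda>v. 0) = kword R s \<epsilon>"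
    using K_cases[OF K_zero] by blast
  have zero': "kword R s \<epsilon> v = 0" for v using zero by (metis (full_types))
  \<comment> \<open>The instance of \<open>kword_add\<close> at \<open>u = 0\<close> shows that the
    part depending on \<open>v\<close> alone vanishes, which leaves the bilinear term.\<close>
  have "2 * lift4 (bdot u (R *v v)) = 0" for u v
    using kword_add[OF S_sym[OF R], of s \<epsilon> u v] kword_add[OF S_sym[OF R], of s \<epsilon> 0 v]
    by (simp add: zero')
  then have "bdot u (R *v v) = 0" for u v by (simp only: twice_lift4_eq_0_iff)
  then have "R *v v = 0" for v by (rule bdot_eq_0D)
  then have "R = 0" by (simp add: matrix_eq)
  with R show ?thesis by simp
qed

lemma S_invertible: "R \<in> S \<Longrightarrow> R \<noteq> 0 \<Longrightarrow> invertible R"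
  using S_diff_invertible[OF _ zero_in_S] by simp

section \<open>Kerdock words separate positions, differences and doubles\<close>

lemma S_surj:
  fixes f :: "_ \<Rightarrow> 'm bvec"
  assumes "inj_on f S"
  shows "f ` S = UNIV"
  using card_image[OF assms] card_S by (intro card_subset_eq) auto

lemma S_mult_vec_surj:
  assumes "w \<noteq> 0"
  shows "(\<lambda>R. R *v w) ` S = UNIV"
proof (rule S_surj, rule inj_onI, rule ccontr)
  fix R R' assume R: "R \<in> S" "R' \<in> S" "R *v w = R' *v w" "R \<noteq> R'"
  then have "(R - R') *v w = 0" by (simp add: matrix_diff_vector_mult)
  with S_diff_invertible[OF R(1,2,4)] assms show False
    by (metis invertible_def matrix_left_invertible_ker)
qed

lemma S_diag_surj: "diag_vec ` S = UNIV"
proof (rule S_surj, rule inj_onI, rule ccontr)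
  fix R R' assume R: "R \<in> S" "R' \<in> S" "diag_vec R = diag_vec R'" "R \<noteq> R'"
  then have "diag_vec (R - R') = 0" by (simp add: diag_vec_diff)
  with diag_vec_nonzero[OF S_diff_sym[OF R(1,2)] S_diff_invertible[OF R(1,2,4)] odd_m] show False by simp
qed

lemma linear_word_in_K: "(\<lambda>v. 2 * lift4 (bdot s v)) \<in> K"
  using kword_in_K[OF zero_in_S, of s 0] by (simp add: kword_def[abs_def])

lemma constant_in_K: "(\<lambda>v. c) \<in> K"
  using kword_in_K[OF zero_in_S, of 0 c] by (simp add: kword_def[abs_def])

text \<open>The right-hand side is twice the value at \<open>l\<close> of the word after subtraction
  of the constant \<open>x i\<close>. Words of the form \<open>2 * lift4 (bdot s v)\<close> vanish
  when doubled, so on them only the difference of \<open>j\<close> and \<open>k\<close> is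
  tested.\<close>

lemma mixed_separated:
  assumes "\<And>x. x \<in> K \<Longrightarrow> x j - x k = 2 * x l - 2 * x i"
  shows "j = k"
proof -
  have "2 * lift4 (bdot s (j - k)) = 0" for s
    using assms[OF linear_word_in_K[of s]]
    unfolding twice_twice_Z4 twice_lift4_diff bdot_diff_right by (simp only: diff_self)
  then have "bdot s (j - k) = 0" for s by (simp only: twice_lift4_eq_0_iff)
  then have "j - k = 0" by (rule bdot_eq_0D)
  then show ?thesis by simp
qed

text \<open>Doubling leaves only the linear form given by the diagonal of \<open>R\<close>, and by
  \<open>S_diag_surj\<close> all linear forms arise in this way.\<close>

lemma doubles_separated:
  assumes "\<And>x. x \<in> K \<Longrightarrow> 2 * x l = 2 * x l'"
  shows "l = l'"
proof -
  have "bdot d (l - l') = 0" for d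
  proof -
    obtain R where R: "R \<in> S" "d = diag_vec R" using S_diag_surj by blast
    have "2 * quad_form R l = 2 * quad_form R l'"
      using assms[OF kword_in_K[OF R(1), of 0 0]] by (simp add: kword_def)
    then have "2 * lift4 (bdot d l) - 2 * lift4 (bdot d l') = 0"
      unfolding twice_quad_form R(2) by simp
    then show ?thesis
      unfolding twice_lift4_diff twice_lift4_eq_0_iff bdot_diff_right .
  qed
  then have "l - l' = 0" by (rule bdot_eq_0D)
  then show ?thesis by simp
qed

text \<open>Doubled linear forms determine the difference \<open>w\<close> of the two positions. For
  a quadratic word the difference of its values at \<open>k + w\<close> and \<open>k\<close> is, by
  polarization, independent of \<open>k\<close> up to \<open>2 * lift4 (bdot k (R *v w))\<close>.
  Since \<open>w\<close> is nonzero, \<open>R *v w\<close> runs through all vectors and so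
  determines \<open>k\<close>.\<close>

lemma pairs_separated:
  assumes eq: "\<And>x. x \<in> K \<Longrightarrow> x j - x k = x j' - x k'" and "j \<noteq> k"
  shows "j = j' \<and> k = k'"
proof -
  define w where "w = j - k"
  have "w \<noteq> 0" using \<open>j \<noteq> k\<close> by (simp add: w_def)
  have "bdot s (w - (j' - k')) = 0" for s
  proof -
    have "2 * lift4 (bdot s j) - 2 * lift4 (bdot s k) - (2 * lift4 (bdot s j') - 2 * lift4 (bdot s k')) = 0"
      using eq[OF linear_word_in_K[of s]] by simp
    then show ?thesis
      unfolding twice_lift4_diff twice_lift4_eq_0_iff w_def bdot_diff_right .
  qed
  then have "w - (j' - k') = 0" by (rule bdot_eq_0D)
  then have j: "j = k + w" and j': "j' = k' + w" by (simp_all add: w_def algebra_simps)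
  have "bdot r (k - k') = 0" for r
  proof -
    obtain R where R: "R \<in> S" "r = R *v w" using S_mult_vec_surj[OF \<open>w \<noteq> 0\<close>] by blast
    have "2 * lift4 (bdot k r) = 2 * lift4 (bdot k' r)"
      using eq[OF kword_in_K[OF R(1), of 0 0]] kword_add[OF S_sym[OF R(1)], of 0 0 k w]
        kword_add[OF S_sym[OF R(1)], of 0 0 k' w]
      unfolding j j' R(2) by (simp add: algebra_simps)
    then have "2 * lift4 (bdot k r) - 2 * lift4 (bdot k' r) = 0" by simp
    then show ?thesis
      unfolding twice_lift4_diff twice_lift4_eq_0_iff bdot_commute[of _ r] bdot_diff_right .
  qed
  then have "k - k' = 0" by (rule bdot_eq_0D)
  then show ?thesis using j j' by simp
qed

lemma K_word_types:
  assumes x: "x \<in> K" and i: "x i = 0"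
  obtains (zero) "x = (\<lambda>v. 0)"
  | (nonlinear) "(Re (exp_sum x))\<^sup>2 = 2 ^ (CARD('m) - 1)" "exp_sum x * cnj (exp_sum x) = 2 ^ CARD('m)"
      "(\<Sum>v\<in>UNIV. i_power (2 * x v)) = 0"
  | (linear) "exp_sum x = 0" "(\<Sum>v\<in>UNIV. i_power (2 * x v)) = 2 ^ CARD('m)"
proof -
  obtain R s \<epsilon> where R: "R \<in> S" and x_eq: "x = kword R s \<epsilon>" using K_cases[OF x] .
  consider "R \<noteq> 0" | "R = 0" "s \<noteq> 0" | "R = 0" "s = 0" by blast
  then show ?thesis
  proof cases
    case 1
    note inv = S_invertible[OF R 1] and sym = S_sym[OF R]
    show ?thesis
      unfolding x_eq
      by (rule nonlinear; unfold x_eq)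
        (intro exp_sum_re_im[OF sym inv odd_m] exp_sum_norm[OF sym inv]
          sum_twice_kword diag_vec_nonzero[OF sym inv odd_m])+
  next
    case 2
    have x_v: "x v = 2 * lift4 (bdot v s) + \<epsilon>" for v
      by (simp add: x_eq kword_def 2 bdot_commute)
    have "exp_sum x = (\<Sum>v\<in>UNIV. i_power (2 * lift4 (bdot v s))) * i_power \<epsilon>"
      by (simp only: exp_sum_def x_v i_power_add sum_distrib_right)
    then have W: "exp_sum x = 0" using 2 by (simp add: sum_bdot_character)
    have two: "2 * x v = 2 * \<epsilon>" for v
      unfolding x_v distrib_left twice_twice_Z4 by (simp only: add_0_left)
    \<comment> \<open>Vanishing at \<open>i\<close> forces the constant to be 0 or 2, so all values
      of the word lie in {0, 2}.\<close>
    have "2 * \<epsilon> = 0" using two[of i] i by simp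
    then have "(\<Sum>v\<in>UNIV. i_power (2 * x v)) = 2 ^ CARD('m)"
      unfolding two by (simp add: CARD_bit)
    with W show ?thesis by (rule linear)
  next
    case 3
    then have "x v = \<epsilon>" for v by (simp add: x_eq kword_def)
    with i have "x = (\<lambda>v. 0)" by auto
    then show ?thesis by (rule zero)
  qed
qed

end

section \<open>The shortened Kerdock code and its dual group\<close>

locale shortened_kerdock = linear_kerdock S K
  for S :: "(bit^'m::{finite,linorder}^'m::{finite,linorder}) set" and K +
  fixes i :: "'m bvec" and I :: "'m bvec set" and Kshort C :: "('m bvec \<Rightarrow> 4) set"
    and A G :: "('m bvec \<Rightarrow> 4) monoid" and e :: "'m bvec \<Rightarrow> 'm bvec \<Rightarrow> 4"
  assumes I: "I = UNIV - {i}"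
    and Kshort: "Kshort = shorten UNIV i K"
    and C: "C = puncture UNIV i (dual_code UNIV K)"
    and A: "A = word_group I"
    and G: "G = A\<lparr>carrier := Kshort\<rparr>"
    and e: "e = unit_word I"
begin

text \<open>Inverts the deletion of position \<open>i\<close> on words vanishing there, so that sums
  over the whole space apply to shortened words.\<close>

definition extend :: "('m bvec \<Rightarrow> 4) \<Rightarrow> 'm bvec \<Rightarrow> 4"
  where "extend x v = (if v = i then 0 else x v)"

lemma extend_i [simp]: "extend x i = 0"
  by (simp add: extend_def)

lemma Kshort_iff: "x \<in> Kshort \<longleftrightarrow> x \<in> extensional I \<and> extend x \<in> K"
proof
  assume "x \<in> Kshort"
  then obtain y where y: "y \<in> K" "y i = 0" "x = restrict y I"
    by (auto simp: Kshort shorten_def I)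
  then have "extend x = y" by (auto simp: fun_eq_iff extend_def I)
  with y show "x \<in> extensional I \<and> extend x \<in> K" by auto
next
  assume x: "x \<in> extensional I \<and> extend x \<in> K"
  have "x = restrict (extend x) I"
  proof (rule extensionalityI)
    show "x \<in> extensional I" using x by simp
  qed (auto simp: extend_def I)
  with x show "x \<in> Kshort" by (force simp: Kshort shorten_def I)
qed

text \<open>Constants belong to \<open>K\<close>, so every word of \<open>K\<close>, and not only
  those vanishing at \<open>i\<close>, yields a test word in \<open>Kshort\<close>.\<close>

lemma normalized_in_Kshort:
  assumes "x \<in> K"
  shows "(\<lambda>v\<in>I. x v - x i) \<in> Kshort" and "extend (\<lambda>v\<in>I. x v - x i) v = x v - x i"
proof -
  show eq: "extend (\<lambda>v\<in>I. x v - x i) v = x v - x i" for v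
    by (simp add: extend_def I)
  have "(\<lambda>v. x v + - x i) \<in> K" using assms constant_in_K K_add by blast
  then have "(\<lambda>v. x v - x i) \<in> K" by simp
  moreover have "extend (\<lambda>v\<in>I. x v - x i) = (\<lambda>v. x v - x i)" by (rule ext) (rule eq)
  ultimately show "(\<lambda>v\<in>I. x v - x i) \<in> Kshort" by (simp add: Kshort_iff)
qed

sublocale A: comm_group A
  unfolding A by (rule comm_group_word_group)

lemma carrier_A: "carrier A = extensional I"
  and mult_A: "x \<otimes>\<^bsub>A\<^esub> y = (\<lambda>j\<in>I. x j + y j)"
  and one_A: "\<one>\<^bsub>A\<^esub> = (\<lambda>j\<in>I. 0)"
  and inv_A: "x \<in> extensional I \<Longrightarrow> inv\<^bsub>A\<^esub> x = (\<lambda>j\<in>I. - x j)"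
  by (simp_all add: A carrier_word_group mult_word_group one_word_group inv_word_group)

lemma extend_mult: "extend (x \<otimes>\<^bsub>A\<^esub> y) = (\<lambda>v. extend x v + extend y v)"
  by (auto simp: mult_A extend_def I fun_eq_iff)

lemma extend_inv: "x \<in> extensional I \<Longrightarrow> extend (inv\<^bsub>A\<^esub> x) = (\<lambda>v. - extend x v)"
  by (auto simp: inv_A extend_def I fun_eq_iff)

lemma extend_one: "extend \<one>\<^bsub>A\<^esub> = (\<lambda>v. 0)"
  by (auto simp: one_A extend_def I fun_eq_iff)

lemma subgroup_Kshort: "subgroup Kshort A"
proof (rule A.subgroupI)
  show "Kshort \<subseteq> carrier A" by (auto simp: Kshort_iff carrier_A)
  have "\<one>\<^bsub>A\<^esub> \<in> Kshort" unfolding Kshort_iff extend_one using K_zero by (simp add: one_A)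
  then show "Kshort \<noteq> {}" by blast
  show "inv\<^bsub>A\<^esub> x \<in> Kshort" if "x \<in> Kshort" for x
    using that K_uminus[of "extend x"] A.inv_closed[of x] by (simp add: Kshort_iff extend_inv carrier_A)
  show "x \<otimes>\<^bsub>A\<^esub> y \<in> Kshort" if "x \<in> Kshort" "y \<in> Kshort" for x y
    using that K_add[of "extend x" "extend y"] A.m_closed[of x y] by (simp add: Kshort_iff extend_mult carrier_A)
qed

lemma G_simps: "carrier G = Kshort" "x \<otimes>\<^bsub>G\<^esub> y = x \<otimes>\<^bsub>A\<^esub> y" "\<one>\<^bsub>G\<^esub> = \<one>\<^bsub>A\<^esub>"
  by (simp_all add: G)

lemma inv_G: "x \<in> Kshort \<Longrightarrow> inv\<^bsub>G\<^esub> x = inv\<^bsub>A\<^esub> x"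
  unfolding G using subgroup_Kshort by (rule A.m_inv_consistent)

sublocale G: comm_group G
proof (rule group.group_comm_groupI)
  show "group G" unfolding G by (rule A.subgroup_imp_group[OF subgroup_Kshort])
  show "x \<otimes>\<^bsub>G\<^esub> y = y \<otimes>\<^bsub>G\<^esub> x" if "x \<in> carrier G" "y \<in> carrier G" for x y
    using that A.m_comm[of x y] by (simp add: G_simps Kshort_iff carrier_A)
qed

section \<open>Duality between shortening and puncturing\<close>

lemma dot_product_mult_right: "dot_product I x (y \<otimes>\<^bsub>A\<^esub> z) = dot_product I x y + dot_product I x z"
  by (simp add: dot_product_def mult_A distrib_left sum.distrib)

lemma dot_product_mult_left: "dot_product I (x \<otimes>\<^bsub>A\<^esub> y) z = dot_product I x z + dot_product I y z"
  by (simp add: dot_product_def mult_A distrib_right sum.distrib)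

lemma dot_product_inv_right: "y \<in> extensional I \<Longrightarrow> dot_product I x (inv\<^bsub>A\<^esub> y) = - dot_product I x y"
  by (simp add: dot_product_def inv_A sum_negf)

text \<open>Valid also for \<open>k = i\<close>, where both sides are 0: this is what puts the
  deleted position on the same footing as the others.\<close>

lemma dot_product_e: "dot_product I x (e k) = extend x k"
proof (cases "k = i")
  case True
  then show ?thesis by (auto simp: dot_product_def e unit_word_def I intro!: sum.neutral)
next
  case False
  have "dot_product I x (e k) = (\<Sum>j\<in>I. if j = k then x j else 0)"
    unfolding dot_product_def e unit_word_def by (intro sum.cong refl) auto
  with False show ?thesis by (simp add: I extend_def)
qed

lemma dual_code_Kshort: "dual_code I Kshort = C"
proof (intro equalityI subsetI)
  fix y assume "y \<in> dual_code I Kshort"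
  then have y: "y \<in> extensional I" and dual: "\<And>x. x \<in> Kshort \<Longrightarrow> dot_product I x y = 0"
    by (auto simp: dual_code_def carrier_word_group)
  \<comment> \<open>Orthogonality to the constant words forces the entries to sum to 0, which
    determines the entry at \<open>i\<close>. Orthogonality to any other word of \<open>K\<close>
    then follows by subtracting its value at \<open>i\<close>.\<close>
  define z where "z v = (if v = i then - (\<Sum>j\<in>I. y j) else y v)" for v
  have U: "(UNIV :: 'm bvec set) = insert i I" by (auto simp: I)
  have "dot_product UNIV x z = 0" if x: "x \<in> K" for x
  proof -
    have "dot_product UNIV x z = x i * z i + (\<Sum>j\<in>I. x j * z j)"
      unfolding dot_product_def U by (subst sum.insert) (auto simp: I)
    also have "\<dots> = (\<Sum>j\<in>I. x j * y j) - (\<Sum>j\<in>I. x i * y j)"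
      by (simp add: z_def I sum_distrib_left)
    also have "\<dots> = dot_product I (\<lambda>v\<in>I. x v - x i) y"
      by (simp add: dot_product_def left_diff_distrib flip: sum_subtractf)
    also have "\<dots> = 0" using normalized_in_Kshort(1)[OF x] by (rule dual)
    finally show ?thesis .
  qed
  then have "z \<in> dual_code UNIV K" by (simp add: dual_code_def carrier_word_group)
  moreover have "y = restrict z (UNIV - {i})"
    using y by (intro extensionalityI[of _ I]) (auto simp: z_def I)
  ultimately show "y \<in> C" by (auto simp: C puncture_def)
next
  fix y assume "y \<in> C"
  then obtain z where z: "z \<in> dual_code UNIV K" "y = restrict z I" by (auto simp: C puncture_def I)
  have "dot_product I x y = 0" if x: "x \<in> Kshort" for x
  proof -
    have U: "(UNIV :: 'm bvec set) = insert i I" by (auto simp: I)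
    have "dot_product UNIV (extend x) z = extend x i * z i + (\<Sum>j\<in>I. extend x j * z j)"
      unfolding dot_product_def U by (subst sum.insert) (auto simp: I)
    also have "\<dots> = dot_product I x y"
      by (auto simp: dot_product_def z(2) extend_def I intro!: sum.cong)
    finally show ?thesis using z x by (simp add: dual_code_def Kshort_iff)
  qed
  then show "y \<in> dual_code I Kshort" by (simp add: dual_code_def carrier_word_group z(2))
qed

lemma C_iff: "y \<in> C \<longleftrightarrow> y \<in> extensional I \<and> (\<forall>x\<in>Kshort. dot_product I x y = 0)"
  by (auto simp: dual_code_def carrier_word_group simp flip: dual_code_Kshort)

lemma subgroup_C: "subgroup C A"
proof (rule A.subgroupI)
  show "C \<subseteq> carrier A" by (auto simp: C_iff carrier_A)
  have "\<one>\<^bsub>A\<^esub> \<in> C" by (simp add: C_iff one_A dot_product_def)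
  then show "C \<noteq> {}" by blast
  show "inv\<^bsub>A\<^esub> x \<in> C" if "x \<in> C" for x
    using that A.inv_closed[of x] by (simp add: C_iff carrier_A dot_product_inv_right)
  show "x \<otimes>\<^bsub>A\<^esub> y \<in> C" if "x \<in> C" "y \<in> C" for x y
    using that A.m_closed[of x y] by (simp add: C_iff carrier_A dot_product_mult_right)
qed

section \<open>The quotient group and its pairing with the shortened code\<close>

sublocale C: normal C A
  using subgroup_C by (rule A.subgroup_imp_normal)

abbreviation H :: "('m bvec \<Rightarrow> 4) set monoid"
  where "H \<equiv> A Mod C"

sublocale H: comm_group H
  using subgroup_C by (rule A.abelian_FactGroup)

lemma H_mult: "a \<in> carrier A \<Longrightarrow> b \<in> carrier A \<Longrightarrow>
    (C #>\<^bsub>A\<^esub> a) \<otimes>\<^bsub>H\<^esub> (C #>\<^bsub>A\<^esub> b) = C #>\<^bsub>A\<^esub> (a \<otimes>\<^bsub>A\<^esub> b)"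
  by (simp add: C.rcos_sum)

lemma dot_product_coset:
  assumes "x \<in> Kshort" "a \<in> carrier A" "y \<in> C #>\<^bsub>A\<^esub> a"
  shows "dot_product I x y = dot_product I x a"
  using assms by (auto simp: r_coset_def C_iff dot_product_mult_right)

lemma coset_pairing_eq:
  assumes "x \<in> Kshort" "a \<in> carrier A"
  shows "coset_pairing I x (C #>\<^bsub>A\<^esub> a) = dot_product I x a"
proof -
  have "dot_product I x ` (C #>\<^bsub>A\<^esub> a) = {dot_product I x a}"
  proof (rule equalityI)
    show "dot_product I x ` (C #>\<^bsub>A\<^esub> a) \<subseteq> {dot_product I x a}"
      using dot_product_coset[OF assms] by blast
    show "{dot_product I x a} \<subseteq> dot_product I x ` (C #>\<^bsub>A\<^esub> a)"
      using A.rcos_self[OF assms(2) subgroup_C] by blast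
  qed
  then show ?thesis by (simp add: coset_pairing_def)
qed

lemma H_cases:
  assumes "Y \<in> carrier H"
  obtains a where "a \<in> carrier A" "Y = C #>\<^bsub>A\<^esub> a"
  using assms by (auto simp: carrier_FactGroup)

lemma coset_in_H: "a \<in> carrier A \<Longrightarrow> C #>\<^bsub>A\<^esub> a \<in> carrier H"
  by (auto simp: carrier_FactGroup)

lemma coset_pairing_well_defined:
  assumes "x \<in> Kshort" "Y \<in> carrier H" "y \<in> Y"
  shows "coset_pairing I x Y = dot_product I x y"
proof -
  obtain a where "a \<in> carrier A" "Y = C #>\<^bsub>A\<^esub> a" using H_cases[OF assms(2)] .
  with assms show ?thesis by (simp add: coset_pairing_eq dot_product_coset)
qed

lemma e_in_A: "e k \<in> carrier A"
  by (simp add: carrier_A e unit_word_def)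

lemma finite_Kshort: "finite Kshort"
  by (rule finite)

text \<open>On the left the unit words read off the entries of \<open>x\<close>; on the right the
  annihilator of \<open>Kshort\<close> is \<open>C\<close> itself.\<close>

lemma nondegenerate_coset_pairing: "nondegenerate_pairing G H (coset_pairing I)"
  unfolding nondegenerate_pairing_def G_simps
proof (intro conjI ballI impI)
  fix x assume x: "x \<in> Kshort"
  show "coset_pairing I x \<in> hom H Z4"
  proof (rule homI)
    fix Y Z assume "Y \<in> carrier H" "Z \<in> carrier H"
    then obtain a b where "a \<in> carrier A" "Y = C #>\<^bsub>A\<^esub> a" "b \<in> carrier A" "Z = C #>\<^bsub>A\<^esub> b"
      by (metis H_cases)
    with x show "coset_pairing I x (Y \<otimes>\<^bsub>H\<^esub> Z) = coset_pairing I x Y \<otimes>\<^bsub>Z4\<^esub> coset_pairing I x Z"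
      by (simp only: H_mult coset_pairing_eq A.m_closed dot_product_mult_right) (simp add: Z4_def)
  qed (simp add: Z4_def)
  assume zero: "\<forall>Y\<in>carrier H. coset_pairing I x Y = 0"
  have ext_0: "extend x k = 0" for k
    using zero[rule_format, OF coset_in_H[OF e_in_A]] coset_pairing_eq[OF x e_in_A]
    by (simp add: dot_product_e)
  have "x k = 0" if "k \<in> I" for k
    using that ext_0[of k] by (simp add: extend_def I)
  then show "x = \<one>\<^bsub>A\<^esub>"
    using x by (intro extensionalityI[of _ I]) (auto simp: one_A Kshort_iff)
next
  fix Y assume Y: "Y \<in> carrier H"
  then obtain a where a: "a \<in> carrier A" "Y = C #>\<^bsub>A\<^esub> a" by (rule H_cases)
  show "(\<lambda>x. coset_pairing I x Y) \<in> hom G Z4"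
  proof (rule homI)
    fix x y assume "x \<in> carrier G" "y \<in> carrier G"
    then have "x \<in> Kshort" "y \<in> Kshort" "x \<otimes>\<^bsub>A\<^esub> y \<in> Kshort"
      using subgroup.m_closed[OF subgroup_Kshort] by (auto simp: G_simps)
    with a show "coset_pairing I (x \<otimes>\<^bsub>G\<^esub> y) Y = coset_pairing I x Y \<otimes>\<^bsub>Z4\<^esub> coset_pairing I y Y"
      by (simp only: G_simps coset_pairing_eq dot_product_mult_left) (simp add: Z4_def)
  qed (simp add: Z4_def)
  assume zero: "\<forall>x\<in>Kshort. coset_pairing I x Y = 0"
  then have "a \<in> C" using a by (auto simp: C_iff carrier_A coset_pairing_eq)
  then show "Y = \<one>\<^bsub>H\<^esub>"
    using A.coset_join2[OF a(1) subgroup_C] a by simp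
qed

lemma finite_H: "finite (carrier H)"
  by (simp add: carrier_FactGroup)

lemma pairing: "z4_pairing G H (coset_pairing I)"
  by unfold_locales
    (use finite_Kshort nondegenerate_coset_pairing finite_H in \<open>simp_all only: G_simps\<close>)

text \<open>The diagonal pairs, useless for differences, carry the doubles. Since \<open>e i\<close>
  is zero, the pair \<open>(i, i)\<close> gives \<open>C\<close>, and pairs with one entry
  \<open>i\<close> give the cosets of plus or minus a unit word.\<close>

definition phi :: "'m bvec \<times> 'm bvec \<Rightarrow> ('m bvec \<Rightarrow> 4) set"
  where "phi = (\<lambda>(j, k). C #>\<^bsub>A\<^esub> (if j = k then e j \<otimes>\<^bsub>A\<^esub> e j else e j \<otimes>\<^bsub>A\<^esub> inv\<^bsub>A\<^esub> e k))"

lemma phi_in_H: "phi p \<in> carrier H"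
  by (cases p) (simp add: phi_def coset_in_H e_in_A)

lemma coset_pairing_phi:
  assumes "x \<in> Kshort"
  shows "coset_pairing I x (phi (j, k)) = (if j = k then 2 * extend x j else extend x j - extend x k)"
proof -
  have "e k \<in> extensional I" using e_in_A by (simp add: carrier_A)
  then show ?thesis
    using assms
    by (auto simp: phi_def coset_pairing_eq e_in_A dot_product_mult_right dot_product_inv_right dot_product_e)
qed

lemma inj_phi: "inj phi"
proof (rule injI)
  fix p p' assume eq: "phi p = phi p'"
  obtain j k j' k' where p: "p = (j, k)" "p' = (j', k')" by (metis surj_pair)
  \<comment> \<open>Equality of cosets is restated for all words of \<open>K\<close>. Subtracting
    \<open>x i\<close> cancels in differences but leaves \<open>2 * x i\<close> in doubles.\<close>
  have *: "(if j = k then 2 * (x j - x i) else x j - x k) =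
      (if j' = k' then 2 * (x j' - x i) else x j' - x k')" if x: "x \<in> K" for x
  proof -
    let ?y = "\<lambda>v\<in>I. x v - x i"
    have "coset_pairing I ?y (phi (j, k)) = coset_pairing I ?y (phi (j', k'))"
      using eq p by simp
    then show ?thesis
      unfolding coset_pairing_phi[OF normalized_in_Kshort(1)[OF x]] normalized_in_Kshort(2)[OF x]
      by (simp split: if_splits)
  qed
  consider "j \<noteq> k" "j' \<noteq> k'" | "j \<noteq> k" "j' = k'" | "j = k" "j' \<noteq> k'" | "j = k" "j' = k'" by blast
  then show "p = p'"
  proof cases
    case 1
    then show ?thesis using pairs_separated[of j k j' k'] * p by auto
  next
    case 2
    then show ?thesis using mixed_separated[of j k j' i] * by (auto simp: right_diff_distrib)
  next
    case 3
    then show ?thesis using mixed_separated[of j' k' j i] *[symmetric] by (auto simp: right_diff_distrib)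
  next
    case 4
    then show ?thesis using doubles_separated[of j j'] * p by (auto simp: right_diff_distrib)
  qed
qed

text \<open>Vanishing at \<open>i\<close> determines the constant \<open>\<epsilon>\<close>, so a
  shortened word is given by \<open>R\<close> and \<open>s\<close>. The reverse inequality comes
  from the cosets.\<close>

lemma card_Kshort_le: "card Kshort \<le> 4 ^ CARD('m)"
proof -
  let ?f = "\<lambda>(R, s). restrict (kword R s (- (quad_form R i + 2 * lift4 (bdot s i)))) I"
  have "Kshort \<subseteq> ?f ` (S \<times> UNIV)"
  proof
    fix x assume "x \<in> Kshort"
    then obtain y where y: "y \<in> K" "y i = 0" "x = restrict y I" by (auto simp: Kshort shorten_def I)
    obtain R s \<epsilon> where R: "R \<in> S" "y = kword R s \<epsilon>" using K_cases[OF y(1)] .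
    have "\<epsilon> = - (quad_form R i + 2 * lift4 (bdot s i))"
      using y(2) unfolding R(2) kword_def by (simp only: eq_neg_iff_add_eq_0 add.commute)
    with y R show "x \<in> ?f ` (S \<times> UNIV)" by (intro image_eqI[of _ _ "(R, s)"]) auto
  qed
  then have "card Kshort \<le> card (?f ` (S \<times> UNIV))" by (intro card_mono) simp_all
  also have "\<dots> \<le> card (S \<times> (UNIV :: 'm bvec set))" by (intro card_image_le) simp
  also have "\<dots> = (2 * 2) ^ CARD('m)" unfolding card_cartesian_product card_S CARD_bvec power_mult_distrib ..
  finally show ?thesis by simp
qed

lemma card_H_eq: "card (carrier H) = card Kshort"
  using z4_pairing.card_eq[OF pairing] by (simp add: G_simps)

lemma card_range_phi: "card (range phi) = 4 ^ CARD('m)"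
proof -
  have "card (range phi) = CARD('m bvec \<times> 'm bvec)" by (rule card_image[OF inj_phi])
  also have "\<dots> = (2 * 2) ^ CARD('m)" unfolding card_prod CARD_bvec power_mult_distrib ..
  finally show ?thesis by simp
qed

text \<open>Two bounds meet: \<open>phi\<close> supplies 4^m cosets, while nondegeneracy gives |A/C|
  = |Kshort|, which is at most 4^m.\<close>

lemma range_phi: "range phi = carrier H"
proof (rule card_seteq[OF finite_H])
  show "range phi \<subseteq> carrier H" using phi_in_H by auto
  show "card (carrier H) \<le> card (range phi)"
    unfolding card_H_eq card_range_phi by (rule card_Kshort_le)
qed

lemma card_H: "card (carrier H) = 4 ^ CARD('m)"
  using card_range_phi range_phi by simp

lemma card_Kshort: "card Kshort = 4 ^ CARD('m)"
  using card_H card_H_eq by simp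

end

lemma le_3_cases:
  fixes j :: nat
  assumes "j \<le> 3"
  obtains "j = 0" | "j = 1" | "j = 2" | "j = 3"
  using assms by linarith

sublocale shortened_kerdock \<subseteq> pair: z4_pairing G "A Mod C" "coset_pairing I"
  by (rule pairing)

section \<open>The two partitions\<close>

context shortened_kerdock
begin

definition weight_class :: "nat \<Rightarrow> ('m bvec \<Rightarrow> 4) set"
  where "weight_class j = {x \<in> Kshort. lee_weight I x =
    [0, 2 ^ CARD('m) + 2 ^ ((CARD('m) - 1) div 2), 2 ^ CARD('m) - 2 ^ ((CARD('m) - 1) div 2),
     2 ^ CARD('m)] ! j}"

definition coset_class :: "nat \<Rightarrow> ('m bvec \<Rightarrow> 4) set set"
  where "coset_class j =
    [{C},
     {C #>\<^bsub>A\<^esub> e k | k. k \<in> I} \<union> {C #>\<^bsub>A\<^esub> inv\<^bsub>A\<^esub> e k | k. k \<in> I},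
     {C #>\<^bsub>A\<^esub> (e k \<otimes>\<^bsub>A\<^esub> inv\<^bsub>A\<^esub> e l) | k l. k \<in> I \<and> l \<in> I \<and> k \<noteq> l},
     {C #>\<^bsub>A\<^esub> (e k \<otimes>\<^bsub>A\<^esub> e k) | k. k \<in> I}] ! j"

text \<open>The preimages of the coset classes under the bijection \<open>phi\<close>. On pairs,
  covering and disjointness are a matter of comparing entries.\<close>

definition pair_class :: "nat \<Rightarrow> ('m bvec \<times> 'm bvec) set"
  where "pair_class j =
    [{(i, i)}, (\<lambda>k. (k, i)) ` I \<union> (\<lambda>k. (i, k)) ` I, {(k, l). k \<in> I \<and> l \<in> I \<and> k \<noteq> l},
     (\<lambda>k. (k, k)) ` I] ! j"

lemma I_iff [simp]: "k \<in> I \<longleftrightarrow> k \<noteq> i"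
  by (simp add: I)

lemma e_i: "e i = \<one>\<^bsub>A\<^esub>"
  by (auto simp: e unit_word_def one_A fun_eq_iff)

lemma phi_simps:
  "phi (i, i) = C" "k \<noteq> i \<Longrightarrow> phi (k, i) = C #>\<^bsub>A\<^esub> e k" "k \<noteq> i \<Longrightarrow> phi (i, k) = C #>\<^bsub>A\<^esub> inv\<^bsub>A\<^esub> e k"
  "k \<noteq> l \<Longrightarrow> phi (k, l) = C #>\<^bsub>A\<^esub> (e k \<otimes>\<^bsub>A\<^esub> inv\<^bsub>A\<^esub> e l)" "phi (k, k) = C #>\<^bsub>A\<^esub> (e k \<otimes>\<^bsub>A\<^esub> e k)"
proof -
  show "k \<noteq> l \<Longrightarrow> phi (k, l) = C #>\<^bsub>A\<^esub> (e k \<otimes>\<^bsub>A\<^esub> inv\<^bsub>A\<^esub> e l)" for k l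
    by (simp add: phi_def)
  then show "k \<noteq> i \<Longrightarrow> phi (k, i) = C #>\<^bsub>A\<^esub> e k" "k \<noteq> i \<Longrightarrow> phi (i, k) = C #>\<^bsub>A\<^esub> inv\<^bsub>A\<^esub> e k"
    by (simp_all add: e_i e_in_A)
  show diag: "phi (k, k) = C #>\<^bsub>A\<^esub> (e k \<otimes>\<^bsub>A\<^esub> e k)" for k
    by (simp add: phi_def)
  show "phi (i, i) = C"
    unfolding diag e_i using C.subset by (simp add: A.coset_mult_one)
qed

lemma coset_class_eq:
  assumes "j \<le> 3"
  shows "coset_class j = phi ` pair_class j"
  using assms
proof (cases rule: le_3_cases)
  case 1
  then show ?thesis by (simp add: coset_class_def pair_class_def phi_simps(1))
next
  case 2
  have "(\<lambda>k. phi (k, i)) ` I = {C #>\<^bsub>A\<^esub> e k | k. k \<in> I}"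
    unfolding setcompr_eq_image Collect_mem_eq by (rule image_cong) (simp_all add: phi_simps(2))
  moreover have "(\<lambda>k. phi (i, k)) ` I = {C #>\<^bsub>A\<^esub> inv\<^bsub>A\<^esub> e k | k. k \<in> I}"
    unfolding setcompr_eq_image Collect_mem_eq by (rule image_cong) (simp_all add: phi_simps(3))
  ultimately show ?thesis using 2 by (simp add: coset_class_def pair_class_def image_Un image_image)
next
  case 3
  have "phi ` {(k, l). k \<in> I \<and> l \<in> I \<and> k \<noteq> l} =
      {C #>\<^bsub>A\<^esub> (e k \<otimes>\<^bsub>A\<^esub> inv\<^bsub>A\<^esub> e l) | k l. k \<in> I \<and> l \<in> I \<and> k \<noteq> l}"
  proof (intro equalityI subsetI)
    fix Y assume "Y \<in> phi ` {(k, l). k \<in> I \<and> l \<in> I \<and> k \<noteq> l}"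
    then obtain k l where "k \<in> I" "l \<in> I" "k \<noteq> l" "Y = phi (k, l)" by auto
    then show "Y \<in> {C #>\<^bsub>A\<^esub> (e k \<otimes>\<^bsub>A\<^esub> inv\<^bsub>A\<^esub> e l) | k l. k \<in> I \<and> l \<in> I \<and> k \<noteq> l}"
      by (intro CollectI exI[of _ k] exI[of _ l]) (simp add: phi_simps(4))
  next
    fix Y assume "Y \<in> {C #>\<^bsub>A\<^esub> (e k \<otimes>\<^bsub>A\<^esub> inv\<^bsub>A\<^esub> e l) | k l. k \<in> I \<and> l \<in> I \<and> k \<noteq> l}"
    then obtain k l where "k \<in> I" "l \<in> I" "k \<noteq> l" "Y = C #>\<^bsub>A\<^esub> (e k \<otimes>\<^bsub>A\<^esub> inv\<^bsub>A\<^esub> e l)" by auto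
    then show "Y \<in> phi ` {(k, l). k \<in> I \<and> l \<in> I \<and> k \<noteq> l}"
      by (intro image_eqI[of _ _ "(k, l)"]) (simp_all add: phi_simps(4))
  qed
  with 3 show ?thesis by (simp add: coset_class_def pair_class_def)
next
  case 4
  have "(\<lambda>k. phi (k, k)) ` I = {C #>\<^bsub>A\<^esub> (e k \<otimes>\<^bsub>A\<^esub> e k) | k. k \<in> I}"
    unfolding setcompr_eq_image Collect_mem_eq by (rule image_cong) (simp_all add: phi_simps(5))
  with 4 show ?thesis by (simp add: coset_class_def pair_class_def image_image)
qed

lemma pair_class_cover: "(\<Union>j\<le>3. pair_class j) = UNIV"
proof -
  have "{..3::nat} = {0, 1, 2, 3}" by auto
  then show ?thesis by (auto simp: pair_class_def)
qed

lemma pair_class_disjoint: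
  assumes "j \<le> 3" "k \<le> 3" "j \<noteq> k"
  shows "pair_class j \<inter> pair_class k = {}"
  using assms(3)
  by (cases rule: le_3_cases[OF assms(1)]; cases rule: le_3_cases[OF assms(2)])
    (auto simp: pair_class_def)

lemma coset_class_cover: "(\<Union>j\<le>3. coset_class j) = carrier H"
proof -
  have "(\<Union>j\<le>3. coset_class j) = phi ` (\<Union>j\<le>3. pair_class j)"
    by (simp add: coset_class_eq image_UN)
  then show ?thesis by (simp only: pair_class_cover range_phi)
qed

lemma coset_class_disjoint:
  assumes "j \<le> 3" "k \<le> 3" "j \<noteq> k"
  shows "coset_class j \<inter> coset_class k = {}"
  unfolding coset_class_eq[OF assms(1)] coset_class_eq[OF assms(2)]
  using image_Int[OF inj_phi, of "pair_class j" "pair_class k"] pair_class_disjoint[OF assms] by simp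

text \<open>Swapping negates a difference, while a double is its own inverse modulo 4. Both are
  checked on characters, which separate cosets.\<close>

lemma inv_phi: "inv\<^bsub>H\<^esub> phi (j, k) = phi (k, j)"
proof (rule pair.chi_separates)
  fix x assume x: "x \<in> carrier G"
  then have xK: "x \<in> Kshort" by (simp add: G_simps)
  have "2 * a + 2 * a = 0" for a :: 4
    using twice_twice_Z4[of a] by (simp only: mult_2[of "2 * a"])
  then have "coset_pairing I x (phi (j, k)) + coset_pairing I x (phi (k, j)) = 0"
    unfolding coset_pairing_phi[OF xK] by (cases "j = k") (simp_all only: if_True if_False, auto)
  then have "pair.chi x (phi (j, k)) * pair.chi x (phi (k, j)) = 1"
    by (simp add: pair.chi_def flip: i_power_add)
  then show "pair.chi x (inv\<^bsub>H\<^esub> phi (j, k)) = pair.chi x (phi (k, j))"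
    using x by (simp add: pair.chi_inv_right phi_in_H inverse_unique)
qed (simp_all add: phi_in_H)

lemma coset_class_inv:
  assumes "j \<le> 3" "Y \<in> coset_class j"
  shows "inv\<^bsub>H\<^esub> Y \<in> coset_class j"
proof -
  obtain k l where kl: "(k, l) \<in> pair_class j" "Y = phi (k, l)"
    using assms by (auto simp: coset_class_eq)
  have "(l, k) \<in> pair_class j"
    using kl(1) assms(1) by (cases rule: le_3_cases[OF assms(1)]) (auto simp: pair_class_def)
  with kl assms(1) show ?thesis by (auto simp: coset_class_eq inv_phi)
qed

section \<open>Character sums over the coset classes\<close>

lemma sum_extend:
  fixes f :: "4 \<Rightarrow> complex"
  shows "(\<Sum>k\<in>I. f (extend x k)) = (\<Sum>v\<in>UNIV. f (extend x v)) - f 0"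
proof -
  have U: "(UNIV :: 'm bvec set) = insert i I" by (auto simp: I)
  show ?thesis unfolding U by (subst sum.insert) auto
qed

text \<open>Position \<open>i\<close> contributes 1 to \<open>W\<close>, so the sum over
  \<open>I\<close> is \<open>W - 1\<close>. Class 1 adds this to its conjugate; class 2 is the
  double sum over \<open>I\<close> without its diagonal, whose q - 1 terms all equal 1; class 3 sums
  the doubled word over \<open>I\<close>.\<close>

lemma coset_class_sums:
  assumes x: "x \<in> Kshort"
  defines "W \<equiv> exp_sum (extend x)"
  shows "(\<Sum>Y\<in>coset_class 0. pair.chi x Y) = 1"
    and "(\<Sum>Y\<in>coset_class 1. pair.chi x Y) = (W - 1) + cnj (W - 1)"
    and "(\<Sum>Y\<in>coset_class 2. pair.chi x Y) = (W - 1) * cnj (W - 1) - (2 ^ CARD('m) - 1)"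
    and "(\<Sum>Y\<in>coset_class 3. pair.chi x Y) = (\<Sum>v\<in>UNIV. i_power (2 * extend x v)) - 1"
proof -
  have red: "(\<Sum>Y\<in>coset_class j. pair.chi x Y) = (\<Sum>p\<in>pair_class j. pair.chi x (phi p))" if "j \<le> 3" for j
    unfolding coset_class_eq[OF that] by (subst sum.reindex) (auto intro: inj_on_subset[OF inj_phi])
  have chi: "pair.chi x (phi (j, k)) =
      (if j = k then i_power (2 * extend x j) else i_power (extend x j) * cnj (i_power (extend x k)))" for j k
    by (simp add: pair.chi_def coset_pairing_phi[OF x] i_power_diff)
  have W1: "(\<Sum>k\<in>I. i_power (extend x k)) = W - 1"
    unfolding W_def exp_sum_def by (simp add: sum_extend)
  show "(\<Sum>Y\<in>coset_class 0. pair.chi x Y) = 1"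
    by (simp add: red pair_class_def chi)
  have "(\<Sum>Y\<in>coset_class 1. pair.chi x Y) =
      (\<Sum>k\<in>I. pair.chi x (phi (k, i))) + (\<Sum>k\<in>I. pair.chi x (phi (i, k)))"
    by (simp add: red pair_class_def)
      (subst sum.union_disjoint, auto simp: sum.reindex inj_on_def)
  also have "\<dots> = (\<Sum>k\<in>I. i_power (extend x k)) + cnj (\<Sum>k\<in>I. i_power (extend x k))"
    unfolding cnj_sum chi by (intro arg_cong2[where f = "(+)"] sum.cong refl) auto
  finally show "(\<Sum>Y\<in>coset_class 1. pair.chi x Y) = (W - 1) + cnj (W - 1)"
    by (simp only: W1)
  show "(\<Sum>Y\<in>coset_class 3. pair.chi x Y) = (\<Sum>v\<in>UNIV. i_power (2 * extend x v)) - 1"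
    using sum_extend[of "\<lambda>a. i_power (2 * a)" x]
    by (simp add: red pair_class_def sum.reindex inj_on_def chi)
  let ?g = "\<lambda>(k, l). i_power (extend x k) * cnj (i_power (extend x l))"
  have norm: "i_power a * cnj (i_power a) = 1" for a
    by (cases a rule: exhaust_Z4) simp_all
  have fin: "finite I" by simp
  have IxI: "I \<times> I = pair_class 2 \<union> (\<lambda>k. (k, k)) ` I" by (auto simp: pair_class_def)
  have "(W - 1) * cnj (W - 1) = (\<Sum>p\<in>I \<times> I. ?g p)"
    unfolding W1[symmetric] cnj_sum sum_product by (simp add: sum.cartesian_product)
  also have "\<dots> = (\<Sum>p\<in>pair_class 2. ?g p) + (\<Sum>p\<in>(\<lambda>k. (k, k)) ` I. ?g p)"
    unfolding IxI by (rule sum.union_disjoint) (auto simp: pair_class_def)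
  also have "(\<Sum>p\<in>(\<lambda>k. (k, k)) ` I. ?g p) = of_nat (card I)"
    by (subst sum.reindex) (simp_all add: inj_on_def norm)
  also have "card I = 2 ^ CARD('m) - 1"
    by (simp add: I card_Diff_singleton CARD_bit)
  also have "(\<Sum>p\<in>pair_class 2. ?g p) = (\<Sum>p\<in>pair_class 2. pair.chi x (phi p))"
    by (intro sum.cong refl) (auto simp: pair_class_def chi)
  finally show "(\<Sum>Y\<in>coset_class 2. pair.chi x Y) = (W - 1) * cnj (W - 1) - (2 ^ CARD('m) - 1)"
    by (simp add: red of_nat_diff)
qed

lemma lee_weight_eq:
  "real (lee_weight I x) = 2 ^ CARD('m) - Re (exp_sum (extend x))"
proof -
  have lee: "real (lee_weight1 a) = 1 - Re (i_power a)" for a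
    by (cases a rule: exhaust_Z4) (simp_all add: lee_weight1_def)
  have "real (lee_weight I x) = (\<Sum>k\<in>I. 1 - Re (i_power (x k)))"
    by (simp add: lee_weight_def lee)
  also have "\<dots> = (\<Sum>k\<in>I. 1 - Re (i_power (extend x k)))"
    by (intro sum.cong refl) (auto simp: extend_def)
  also have "\<dots> = real (card I) - Re (\<Sum>k\<in>I. i_power (extend x k))"
    by (simp add: sum_subtractf)
  also have "(\<Sum>k\<in>I. i_power (extend x k)) = exp_sum (extend x) - 1"
    by (simp add: exp_sum_def sum_extend)
  also have "card I = 2 ^ CARD('m) - 1"
    by (simp add: I card_Diff_singleton CARD_bit)
  finally show ?thesis by (simp add: of_nat_diff)
qed

end

section \<open>The eigenmatrices\<close>

lemma sqrt_four_square: "t \<ge> 0 \<Longrightarrow> sqrt (4 * t\<^sup>2) = 2 * t" for t :: real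
  by (simp add: real_sqrt_mult)

lemma atMost_3: "{..3::nat} = {0, 1, 2, 3}"
  by auto

text \<open>With \<open>N = 4 t^2\<close> the root of \<open>N\<close> is \<open>2 t\<close> and all
  entries are polynomials in \<open>t\<close>. The constant \<open>4 t^4 = N^2 / 4\<close> is the
  order of the shortened code.\<close>

lemma Q_P_matrix:
  fixes t :: real
  assumes "t \<ge> 0" "j \<le> 3" "k \<le> 3"
  shows "(\<Sum>l\<le>3. Q_matrix (4 * t\<^sup>2) j l * P_matrix (4 * t\<^sup>2) l k) = (if j = k then 4 * t ^ 4 else 0)"
proof -
  have "j \<in> {0, 1, 2, 3}" "k \<in> {0, 1, 2, 3}" using assms atMost_3 by auto
  then show ?thesis
    unfolding atMost_3 Q_matrix_def P_matrix_def sqrt_four_square[OF assms(1)]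
    by (elim insertE emptyE) (simp_all add: field_simps power2_eq_square power4_eq_xxxx)
qed

context shortened_kerdock
begin

text \<open>This is half of \<open>sqrt N\<close>, the absolute value of the real part of
  \<open>exp_sum\<close> for a nonsingular form; it is an integer because m is odd.\<close>

definition halfroot :: real
  where "halfroot = 2 ^ ((CARD('m) - 1) div 2)"

lemma halfroot_pos: "halfroot > 0"
  by (simp add: halfroot_def)

lemma halfroot_square: "halfroot\<^sup>2 = 2 ^ (CARD('m) - 1)" "2 ^ CARD('m) = 2 * halfroot\<^sup>2"
proof -
  obtain k where k: "CARD('m) = 2 * k + 1" using odd_m by (elim oddE)
  show "halfroot\<^sup>2 = 2 ^ (CARD('m) - 1)" by (simp add: halfroot_def k power_mult mult.commute)
  then show "2 ^ CARD('m) = 2 * halfroot\<^sup>2" by (simp add: k)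
qed

lemma halfroot_ge_2: "CARD('m) \<ge> 3 \<Longrightarrow> halfroot \<ge> 2"
  unfolding halfroot_def using power_increasing[of 1 "(CARD('m) - 1) div 2" "2::real"] by simp

section \<open>Weight classes in terms of the exponential sum\<close>

lemma Re_values_distinct:
  assumes "CARD('m) \<ge> 3"
  shows "2 * halfroot\<^sup>2 \<noteq> halfroot" "2 * halfroot\<^sup>2 \<noteq> - halfroot" "2 * halfroot\<^sup>2 \<noteq> 0" "halfroot \<noteq> - halfroot" "halfroot \<noteq> 0"
proof -
  have "2 * halfroot\<^sup>2 > halfroot"
    using halfroot_ge_2[OF assms] by (simp add: power2_eq_square)
  then show "2 * halfroot\<^sup>2 \<noteq> halfroot" "2 * halfroot\<^sup>2 \<noteq> - halfroot" "2 * halfroot\<^sup>2 \<noteq> 0" "halfroot \<noteq> - halfroot" "halfroot \<noteq> 0"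
    using halfroot_pos by auto
qed

text \<open>By \<open>lee_weight_eq\<close> a larger weight means a smaller real part, so the class
  of the larger nonlinear weight has the negative value \<open>- halfroot\<close>.\<close>

lemma weight_class_iff:
  assumes "j \<le> 3" "x \<in> Kshort"
  shows "x \<in> weight_class j \<longleftrightarrow> Re (exp_sum (extend x)) = [2 * halfroot\<^sup>2, - halfroot, halfroot, 0] ! j"
proof -
  let ?w = "[0, 2 ^ CARD('m) + 2 ^ ((CARD('m) - 1) div 2), 2 ^ CARD('m) - 2 ^ ((CARD('m) - 1) div 2),
     2 ^ CARD('m)] ! j :: nat"
  \<comment> \<open>Ensures that the subtraction of natural numbers in the third weight is not
    truncated.\<close>
  have le: "(2::nat) ^ ((CARD('m) - 1) div 2) \<le> 2 ^ CARD('m)" by (intro power_increasing) auto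
  have half: "(2::real) ^ ((CARD('m) - Suc 0) div 2) = halfroot" by (simp add: halfroot_def)
  have "real ?w = 2 * halfroot\<^sup>2 - [2 * halfroot\<^sup>2, - halfroot, halfroot, 0] ! j"
    using assms(1) by (cases rule: le_3_cases)
      (simp_all add: of_nat_diff[OF le] halfroot_square(2) half)
  moreover have "x \<in> weight_class j \<longleftrightarrow> real (lee_weight I x) = real ?w"
    unfolding weight_class_def using assms(2) by (simp only: mem_Collect_eq of_nat_eq_iff simp_thms)
  ultimately show ?thesis
    unfolding lee_weight_eq halfroot_square(2) by auto
qed

lemma extend_eq_0_iff: "x \<in> Kshort \<Longrightarrow> extend x = (\<lambda>v. 0) \<longleftrightarrow> x = \<one>\<^bsub>A\<^esub>"
proof
  assume x: "x \<in> Kshort" and zero: "extend x = (\<lambda>v. 0)"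
  have "x k = 0" if "k \<in> I" for k
    using fun_cong[OF zero, of k] that by (simp add: extend_def)
  then show "x = \<one>\<^bsub>A\<^esub>"
    using x by (intro extensionalityI[of _ I]) (auto simp: one_A Kshort_iff)
qed (simp add: extend_one)

lemma exp_sum_0: "exp_sum (\<lambda>v::'m bvec. 0) = of_real (2 * halfroot\<^sup>2)"
  by (simp add: exp_sum_def CARD_bit flip: halfroot_square(2))

text \<open>With q equal to \<open>2 * halfroot^2\<close>, the lists contain q^2, q, q, 0 for the
  squared modulus of \<open>exp_sum\<close> and q, 0, 0, q for the sum of the doubled word; the
  middle entries come from nonsingular forms, the last from linear ones.\<close>

lemma word_class:
  assumes m: "CARD('m) \<ge> 3" and x: "x \<in> Kshort"
  obtains j where "j \<le> 3" "x \<in> weight_class j" "j = 0 \<longleftrightarrow> x = \<one>\<^bsub>A\<^esub>"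
    "exp_sum (extend x) * cnj (exp_sum (extend x)) = of_real ([4 * halfroot ^ 4, 2 * halfroot\<^sup>2, 2 * halfroot\<^sup>2, 0] ! j)"
    "(\<Sum>v\<in>UNIV. i_power (2 * extend x v)) = of_real ([2 * halfroot\<^sup>2, 0, 0, 2 * halfroot\<^sup>2] ! j)"
proof -
  have K: "extend x \<in> K" "extend x i = 0" using x by (simp_all add: Kshort_iff)
  have pow: "(2::complex) ^ CARD('m) = of_real (2 * halfroot\<^sup>2)" by (simp flip: halfroot_square(2))
  note distinct = Re_values_distinct[OF m]
  have nonzero: "x \<noteq> \<one>\<^bsub>A\<^esub>" if "Re (exp_sum (extend x)) \<noteq> 2 * halfroot\<^sup>2"
  proof
    assume "x = \<one>\<^bsub>A\<^esub>"
    then have "exp_sum (extend x) = of_real (2 * halfroot\<^sup>2)" by (simp only: extend_one exp_sum_0)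
    with that show False by simp
  qed
  from K show thesis
  proof (cases rule: K_word_types)
    case zero
    then have one: "x = \<one>\<^bsub>A\<^esub>" using extend_eq_0_iff[OF x] by simp
    have W: "exp_sum (extend x) = of_real (2 * halfroot\<^sup>2)" unfolding zero by (rule exp_sum_0)
    have "x \<in> weight_class 0" unfolding weight_class_iff[OF le0 x] W by simp
    moreover have "exp_sum (extend x) * cnj (exp_sum (extend x)) = of_real (4 * halfroot ^ 4)"
      unfolding W by (simp add: power4_eq_xxxx power2_eq_square)
    moreover have "(\<Sum>v\<in>UNIV. i_power (2 * extend x v)) = of_real (2 * halfroot\<^sup>2)"
      unfolding zero by (simp add: CARD_bit flip: halfroot_square(2))
    ultimately show thesis using that[of 0] one by simp
  next
    case nonlinear
    have "Re (exp_sum (extend x)) = halfroot \<or> Re (exp_sum (extend x)) = - halfroot"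
      using nonlinear(1) unfolding halfroot_square(1)[symmetric] power2_eq_iff .
    then show thesis
    proof
      assume re: "Re (exp_sum (extend x)) = halfroot"
      then have "x \<in> weight_class 2" using weight_class_iff[of 2 x] x by simp
      then show thesis
        using that[of 2] nonlinear(2,3) nonzero distinct unfolding re pow by simp
    next
      assume re: "Re (exp_sum (extend x)) = - halfroot"
      then have "x \<in> weight_class 1" using weight_class_iff[of 1 x] x by simp
      then show thesis
        using that[of 1] nonlinear(2,3) nonzero distinct unfolding re pow by simp
    qed
  next
    case linear
    then have "x \<in> weight_class 3" using weight_class_iff[of 3 x] x by simp
    then show thesis
      using that[of 3] linear nonzero distinct unfolding linear(1) pow by simp
  qed
qed

lemma weight_class_disjoint:
  assumes m: "CARD('m) \<ge> 3" and jk: "j \<le> 3" "k \<le> 3" "j \<noteq> k"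
  shows "weight_class j \<inter> weight_class k = {}"
proof -
  have "[2 * halfroot\<^sup>2, - halfroot, halfroot, 0] ! j \<noteq> [2 * halfroot\<^sup>2, - halfroot, halfroot, 0] ! k"
    using jk(3) Re_values_distinct[OF m]
    by (cases rule: le_3_cases[OF jk(1)]; cases rule: le_3_cases[OF jk(2)]) auto
  moreover have "[2 * halfroot\<^sup>2, - halfroot, halfroot, 0] ! j = [2 * halfroot\<^sup>2, - halfroot, halfroot, 0] ! k"
    if "x \<in> weight_class j" "x \<in> weight_class k" for x
  proof -
    have x: "x \<in> Kshort" using that(1) by (simp add: weight_class_def)
    show ?thesis using weight_class_iff[OF jk(1) x] weight_class_iff[OF jk(2) x] that by argo
  qed
  ultimately show ?thesis by blast
qed

text \<open>A word lies in only one class, so the data that \<open>word_class\<close> finds for some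
  index hold for the given one.\<close>

lemma weight_class_values:
  assumes m: "CARD('m) \<ge> 3" and j: "j \<le> 3" and x: "x \<in> weight_class j"
  shows "j = 0 \<longleftrightarrow> x = \<one>\<^bsub>A\<^esub>"
    and "exp_sum (extend x) * cnj (exp_sum (extend x)) = of_real ([4 * halfroot ^ 4, 2 * halfroot\<^sup>2, 2 * halfroot\<^sup>2, 0] ! j)"
    and "(\<Sum>v\<in>UNIV. i_power (2 * extend x v)) = of_real ([2 * halfroot\<^sup>2, 0, 0, 2 * halfroot\<^sup>2] ! j)"
proof -
  have xK: "x \<in> Kshort" using x by (simp add: weight_class_def)
  obtain k where k: "k \<le> 3" "x \<in> weight_class k" "k = 0 \<longleftrightarrow> x = \<one>\<^bsub>A\<^esub>"
    "exp_sum (extend x) * cnj (exp_sum (extend x)) = of_real ([4 * halfroot ^ 4, 2 * halfroot\<^sup>2, 2 * halfroot\<^sup>2, 0] ! k)"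
    "(\<Sum>v\<in>UNIV. i_power (2 * extend x v)) = of_real ([2 * halfroot\<^sup>2, 0, 0, 2 * halfroot\<^sup>2] ! k)"
    using word_class[OF m xK] .
  have "k = j"
  proof (rule ccontr)
    assume "k \<noteq> j"
    then show False using weight_class_disjoint[OF m k(1) j] k(2) x by blast
  qed
  note k' = k(3-)[unfolded this]
  show "j = 0 \<longleftrightarrow> x = \<one>\<^bsub>A\<^esub>"
    "exp_sum (extend x) * cnj (exp_sum (extend x)) = of_real ([4 * halfroot ^ 4, 2 * halfroot\<^sup>2, 2 * halfroot\<^sup>2, 0] ! j)"
    "(\<Sum>v\<in>UNIV. i_power (2 * extend x v)) = of_real ([2 * halfroot\<^sup>2, 0, 0, 2 * halfroot\<^sup>2] ! j)"
    by (rule k')+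
qed

lemma weight_class_0:
  assumes m: "CARD('m) \<ge> 3"
  shows "weight_class 0 = {\<one>\<^bsub>A\<^esub>}"
proof -
  have "\<one>\<^bsub>A\<^esub> \<in> Kshort" using subgroup.one_closed[OF subgroup_Kshort] .
  then have "\<one>\<^bsub>A\<^esub> \<in> weight_class 0"
    using weight_class_iff[of 0 "\<one>\<^bsub>A\<^esub>"] by (simp add: extend_one exp_sum_0)
  moreover have "x = \<one>\<^bsub>A\<^esub>" if "x \<in> weight_class 0" for x
    using weight_class_values(1)[OF m le0 that] by simp
  ultimately show ?thesis by blast
qed

text \<open>Negating a word conjugates its exponential sum and preserves the real part.\<close>

lemma weight_class_inv:
  assumes "j \<le> 3" "x \<in> weight_class j"
  shows "inv\<^bsub>G\<^esub> x \<in> weight_class j"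
proof -
  have x: "x \<in> Kshort" using assms(2) by (simp add: weight_class_def)
  then have inv: "inv\<^bsub>A\<^esub> x \<in> Kshort" using subgroup.m_inv_closed[OF subgroup_Kshort] by blast
  have "exp_sum (extend (inv\<^bsub>A\<^esub> x)) = cnj (exp_sum (extend x))"
    using x by (simp add: extend_inv Kshort_iff exp_sum_def i_power_uminus)
  then show ?thesis
    using assms weight_class_iff[OF assms(1) x] weight_class_iff[OF assms(1) inv] by (simp add: inv_G x)
qed

lemma weight_class_Q_sum:
  assumes m: "CARD('m) \<ge> 3" and jk: "j \<le> 3" "k \<le> 3" and x: "x \<in> weight_class j"
  shows "(\<Sum>Y\<in>coset_class k. pair.chi x Y) = of_real (Q_matrix (4 * halfroot\<^sup>2) j k)"
proof -
  have xK: "x \<in> Kshort" using x by (simp add: weight_class_def)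
  define W where "W = exp_sum (extend x)"
  have re: "Re W = [2 * halfroot\<^sup>2, - halfroot, halfroot, 0] ! j"
    using x weight_class_iff[OF jk(1) xK] by (simp add: W_def)
  have norm: "W * cnj W = of_real ([4 * halfroot ^ 4, 2 * halfroot\<^sup>2, 2 * halfroot\<^sup>2, 0] ! j)"
    using weight_class_values(2)[OF m jk(1) x] by (simp add: W_def)
  have two_re: "W + cnj W = of_real (2 * Re W)" by (rule complex_add_cnj)
  have s1: "(\<Sum>Y\<in>coset_class 1. pair.chi x Y) = of_real (2 * Re W - 2)"
    using two_re unfolding coset_class_sums(2)[OF xK] W_def[symmetric] by simp
  have "(W - 1) * cnj (W - 1) - (2 ^ CARD('m) - 1) = W * cnj W - (W + cnj W) + 2 - 2 ^ CARD('m)"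
    by (simp add: algebra_simps)
  also have "\<dots> = of_real ([4 * halfroot ^ 4, 2 * halfroot\<^sup>2, 2 * halfroot\<^sup>2, 0] ! j - 2 * Re W + 2 - 2 * halfroot\<^sup>2)"
    unfolding norm two_re by (simp flip: halfroot_square(2))
  finally have s2: "(\<Sum>Y\<in>coset_class 2. pair.chi x Y) =
      of_real ([4 * halfroot ^ 4, 2 * halfroot\<^sup>2, 2 * halfroot\<^sup>2, 0] ! j - 2 * Re W + 2 - 2 * halfroot\<^sup>2)"
    unfolding coset_class_sums(3)[OF xK] W_def[symmetric] .
  have s3: "(\<Sum>Y\<in>coset_class 3. pair.chi x Y) = of_real ([2 * halfroot\<^sup>2, 0, 0, 2 * halfroot\<^sup>2] ! j - 1)"
    unfolding coset_class_sums(4)[OF xK] weight_class_values(3)[OF m jk(1) x] by simp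
  have s0: "(\<Sum>Y\<in>coset_class 0. pair.chi x Y) = of_real 1"
    using coset_class_sums(1)[OF xK] by simp
  have "(\<Sum>Y\<in>coset_class k. pair.chi x Y) = of_real ([1, 2 * Re W - 2,
      [4 * halfroot ^ 4, 2 * halfroot\<^sup>2, 2 * halfroot\<^sup>2, 0] ! j - 2 * Re W + 2 - 2 * halfroot\<^sup>2,
      [2 * halfroot\<^sup>2, 0, 0, 2 * halfroot\<^sup>2] ! j - 1] ! k)"
    using s0 s1 s2 s3 by (cases rule: le_3_cases[OF jk(2)]) simp_all
  also have "[1, 2 * Re W - 2,
      [4 * halfroot ^ 4, 2 * halfroot\<^sup>2, 2 * halfroot\<^sup>2, 0] ! j - 2 * Re W + 2 - 2 * halfroot\<^sup>2,
      [2 * halfroot\<^sup>2, 0, 0, 2 * halfroot\<^sup>2] ! j - 1] ! k = Q_matrix (4 * halfroot\<^sup>2) j k"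
    unfolding Q_matrix_def sqrt_four_square[OF less_imp_le[OF halfroot_pos]] re
    by (cases rule: le_3_cases[OF jk(1)]; cases rule: le_3_cases[OF jk(2)])
      (simp_all add: field_simps power2_eq_square power4_eq_xxxx)
  finally show ?thesis .
qed

lemma dual_partitions_classes:
  assumes m: "CARD('m) \<ge> 3"
  shows "dual_partitions G H (coset_pairing I) 3 weight_class coset_class
    (P_matrix (4 * halfroot\<^sup>2)) (Q_matrix (4 * halfroot\<^sup>2))"
proof (rule pair.dual_partitionsI)
  show "(\<Union>j\<le>3. weight_class j) = carrier G"
  proof (intro equalityI subsetI)
    fix x assume "x \<in> carrier G"
    then have x: "x \<in> Kshort" by (simp only: G_simps)
    obtain j where "j \<le> 3" "x \<in> weight_class j" using word_class[OF m x] .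
    then show "x \<in> (\<Union>j\<le>3. weight_class j)" by blast
  qed (auto simp: weight_class_def G_simps)
  show "(\<Union>j\<le>3. coset_class j) = carrier H" by (rule coset_class_cover)
  show "weight_class 0 = {\<one>\<^bsub>G\<^esub>}" using weight_class_0[OF m] by (simp add: G_simps)
  show "coset_class 0 = {\<one>\<^bsub>H\<^esub>}" by (simp add: coset_class_def)
  have card: "real (card (carrier G)) = 4 * halfroot ^ 4"
  proof -
    have "real (card (carrier G)) = (2 ^ CARD('m))\<^sup>2"
      by (simp add: G_simps card_Kshort power2_eq_square flip: power_mult_distrib)
    then show ?thesis unfolding halfroot_square(2) by (simp add: power_mult_distrib)
  qed
  show "(\<Sum>l\<le>3. Q_matrix (4 * halfroot\<^sup>2) j l * P_matrix (4 * halfroot\<^sup>2) l k) =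
      (if j = k then real (card (carrier G)) else 0)" if "j \<le> 3" "k \<le> 3" for j k
    unfolding card using halfroot_pos that by (intro Q_P_matrix) auto
  \<comment> \<open>Here \<open>m >= 3\<close> is decisive: if \<open>halfroot\<close> were 1, the
    second and fourth factors below would vanish and some classes would be empty.\<close>
  have big: "halfroot\<^sup>2 \<ge> 2 * halfroot" "halfroot \<ge> 2"
    using halfroot_ge_2[OF m] by (auto simp: power2_eq_square)
  have factors: "4 * halfroot\<^sup>2 - 2 \<noteq> 0" "4 * halfroot\<^sup>2 - 4 \<noteq> 0" "4 * halfroot\<^sup>2 / 2 - 1 \<noteq> 0"
    "4 * halfroot\<^sup>2 - 2 * (2 * halfroot) \<noteq> 0" "4 * halfroot\<^sup>2 + 2 * (2 * halfroot) \<noteq> 0"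
    using big by linarith+
  have row: "[[a, b, c, d], r1, r2, r3] ! 0 ! j = [a, b, c, d] ! j" for a b c d :: real and r1 r2 r3 j
    by simp
  have entries: "[1, b, c, d] ! j \<noteq> 0" if "j \<le> 3" "b \<noteq> 0" "c \<noteq> 0" "d \<noteq> 0" for b c d :: real and j
    using that(2-) by (cases rule: le_3_cases[OF that(1)]) simp_all
  show "Q_matrix (4 * halfroot\<^sup>2) 0 j \<noteq> 0" if "j \<le> 3" for j
    unfolding Q_matrix_def row using that
    by (intro entries) (simp_all only: divide_eq_0_iff mult_eq_0_iff factors zero_neq_numeral[symmetric] simp_thms)
  show "P_matrix (4 * halfroot\<^sup>2) 0 j \<noteq> 0" if "j \<le> 3" for j
    unfolding P_matrix_def sqrt_four_square[OF less_imp_le[OF halfroot_pos]] row using that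
    by (intro entries) (simp_all only: divide_eq_0_iff mult_eq_0_iff factors zero_neq_numeral[symmetric] simp_thms)
qed (erule (2) weight_class_disjoint[OF m] coset_class_disjoint weight_class_Q_sum[OF m]
    | erule (1) weight_class_inv coset_class_inv)+

end

theorem theorem1:
  fixes K Prep Kshort C :: "('m::{finite,linorder} bvec \<Rightarrow> 4) set"
    and i :: "'m bvec" and I :: "'m bvec set"
    and m q :: nat and N :: real
    and A G :: "('m bvec \<Rightarrow> 4) monoid"
    and e :: "'m bvec \<Rightarrow> 'm bvec \<Rightarrow> 4"
    and R :: "nat \<Rightarrow> (('m bvec \<Rightarrow> 4) \<times> ('m bvec \<Rightarrow> 4)) set"
    and R' :: "nat \<Rightarrow> (('m bvec \<Rightarrow> 4) set \<times> ('m bvec \<Rightarrow> 4) set) set"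
  assumes m: "m = CARD('m)" "m \<ge> 3" "odd m"
    and q: "q = 2 ^ m" and N: "N = 2 * real q"
    and kerdock: "kerdock_code K"
    and linear: "subgroup K (word_group UNIV)"
    and Prep: "Prep = dual_code UNIV K"
    and I: "I = UNIV - {i}"
    and Kshort: "Kshort = shorten UNIV i K"
    and C: "C = puncture UNIV i Prep"
    and A: "A = word_group I"
    and G: "G = A\<lparr>carrier := Kshort\<rparr>"
    and R: "R = (\<lambda>j. diff_rel G {x. lee_weight I x =
              [0, 2 ^ m + 2 ^ ((m - 1) div 2), 2 ^ m - 2 ^ ((m - 1) div 2), 2 ^ m] ! j})"
    and e: "e = unit_word I"
    and R': "R' = (\<lambda>j. diff_rel (A Mod C)
              ([{C},
                {C #>\<^bsub>A\<^esub> e k | k. k \<in> I} \<union> {C #>\<^bsub>A\<^esub> inv\<^bsub>A\<^esub> e k | k. k \<in> I},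
                {C #>\<^bsub>A\<^esub> (e k \<otimes>\<^bsub>A\<^esub> inv\<^bsub>A\<^esub> e l) | k l. k \<in> I \<and> l \<in> I \<and> k \<noteq> l},
                {C #>\<^bsub>A\<^esub> (e k \<otimes>\<^bsub>A\<^esub> e k) | k. k \<in> I}] ! j))"
  shows "dual_code I Kshort = C \<and> card Kshort = 4 ^ m \<and> card (carrier (A Mod C)) = 4 ^ m \<and>
    abelian_scheme G 3 R \<and>
    abelian_scheme (A Mod C) 3 R' \<and>
    (\<forall>x\<in>Kshort. \<forall>Y\<in>carrier (A Mod C). \<forall>y\<in>Y. coset_pairing I x Y = dot_product I x y) \<and>
    (\<exists>E E'.
      idempotent_ordering Kshort 3 R E \<and>
      first_eigenmatrix 3 R E (P_matrix N) \<and>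
      second_eigenmatrix Kshort 3 R E (Q_matrix N) \<and>
      dual_scheme_via G E (A Mod C) 3 R' (coset_pairing I) \<and>
      idempotent_ordering (carrier (A Mod C)) 3 R' E' \<and>
      first_eigenmatrix 3 R' E' (Q_matrix N) \<and>
      second_eigenmatrix (carrier (A Mod C)) 3 R' E' (P_matrix N))"
proof -
  obtain S where S: "kerdock_set S" "K = kerdock_words S"
    using kerdock by (auto simp: kerdock_code_def)
  have m3: "CARD('m) \<ge> 3" and odd_card: "odd CARD('m)" using m by simp_all
  interpret code: shortened_kerdock S K i I Kshort C A G e
    by (intro shortened_kerdock.intro linear_kerdock.intro shortened_kerdock_axioms.intro
        S linear odd_card I Kshort C[unfolded Prep] A G e)
  have N_eq: "N = 4 * code.halfroot\<^sup>2"
    unfolding N q m(1) using code.halfroot_square(2) by simp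
  interpret scheme: dual_partitions G "A Mod C" "coset_pairing I" 3 code.weight_class code.coset_class
    "P_matrix N" "Q_matrix N"
    unfolding N_eq by (rule code.dual_partitions_classes[OF m3])
  \<comment> \<open>The exchanged interpretation yields the scheme on the cosets, with the two
    eigenmatrices interchanged.\<close>
  interpret dual: dual_partitions "A Mod C" G "\<lambda>Y x. coset_pairing I x Y" 3 code.coset_class
    code.weight_class "Q_matrix N" "P_matrix N"
    by (rule scheme.dual_partitions_flip)
  \<comment> \<open>The given relations restrict only the weight of the quotient; its membership in
    \<open>Kshort\<close> comes from closure of \<open>G\<close>.\<close>
  have R_eq: "R = (\<lambda>j. diff_rel G (code.weight_class j))"
  proof (intro ext equalityI subsetI)
    fix j p assume "p \<in> R j"
    moreover have "x \<otimes>\<^bsub>G\<^esub> inv\<^bsub>G\<^esub> y \<in> Kshort" if "x \<in> carrier G" "y \<in> carrier G" for x y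
      using code.G.m_closed[OF that(1) code.G.inv_closed[OF that(2)]] by (simp only: code.G_simps)
    ultimately show "p \<in> diff_rel G (code.weight_class j)"
      unfolding R diff_rel_def code.weight_class_def m(1) by blast
  next
    fix j p assume "p \<in> diff_rel G (code.weight_class j)"
    then show "p \<in> R j"
      unfolding R diff_rel_def code.weight_class_def m(1) by blast
  qed
  have R'_eq: "R' = (\<lambda>j. diff_rel (A Mod C) (code.coset_class j))"
    unfolding R' code.coset_class_def ..
  have carrier_G: "carrier G = Kshort" by (rule code.G_simps)
  show ?thesis
  proof (intro conjI exI)
    show "dual_code I Kshort = C" by (rule code.dual_code_Kshort)
    show "card Kshort = 4 ^ m" "card (carrier (A Mod C)) = 4 ^ m"
      unfolding m(1) by (rule code.card_Kshort code.card_H)+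
    show "\<forall>x\<in>Kshort. \<forall>Y\<in>carrier (A Mod C). \<forall>y\<in>Y. coset_pairing I x Y = dot_product I x y"
      using code.coset_pairing_well_defined by blast
    show "abelian_scheme G 3 R" unfolding R_eq by (rule scheme.abelian_scheme_Rel)
    show "abelian_scheme (A Mod C) 3 R'" unfolding R'_eq by (rule dual.abelian_scheme_Rel)
    show "idempotent_ordering Kshort 3 R scheme.idem"
      unfolding R_eq by (rule scheme.idempotent_ordering_idem[unfolded carrier_G])
    show "first_eigenmatrix 3 R scheme.idem (P_matrix N)"
      unfolding R_eq by (rule scheme.first_eigenmatrix_idem)
    show "second_eigenmatrix Kshort 3 R scheme.idem (Q_matrix N)"
      unfolding R_eq by (rule scheme.second_eigenmatrix_idem[unfolded carrier_G])
    show "dual_scheme_via G scheme.idem (A Mod C) 3 R' (coset_pairing I)"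
      unfolding R'_eq by (rule scheme.dual_scheme_via_idem)
    show "idempotent_ordering (carrier (A Mod C)) 3 R' dual.idem"
      unfolding R'_eq by (rule dual.idempotent_ordering_idem)
    show "first_eigenmatrix 3 R' dual.idem (Q_matrix N)"
      unfolding R'_eq by (rule dual.first_eigenmatrix_idem)
    show "second_eigenmatrix (carrier (A Mod C)) 3 R' dual.idem (P_matrix N)"
      unfolding R'_eq by (rule dual.second_eigenmatrix_idem)
  qed
qed

end
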